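(* Let $d\ge1$ and let $\{\nu_\varepsilon\}_{\varepsilon>0}$ be a family of positive Borel measures on $\mathbb{R}^d$ with $\int_{\mathbb{R}^d}(1\wedge|x|)\,\nu_\varepsilon(\mathrm{d}x)<\infty$ and $\nu_\varepsilon(\{0\})=0$. For each $\varepsilon>0$ let $R_\varepsilon\in[1,\infty]$, $C_\varepsilon=\int_{\mathbb{R}^d}(R_\varepsilon\wedge|x|)\,\nu_\varepsilon(\mathrm{d}x)$ with $0<C_\varepsilon<\infty$, and $\lambda_\varepsilon(\mathrm{d}x)=C_\varepsilon^{-1}(R_\varepsilon\wedge|x|)\,\nu_\varepsilon(\mathrm{d}x)$. Let $\mu_\varepsilon(S)=\lambda_\varepsilon((0,\infty)S)$ for Borel $S\subset\mathbb{S}^{d-1}$. Suppose that $\lim_{\varepsilon\downarrow0}\lambda_\varepsilon(B_R^c)=0$ for every $R>0$. Then there exist a sequence $\varepsilon_j$ converging to zero and a probability measure $\mu$ on $\mathbb{S}^{d-1}$ which is the weak limit of $\{\mu_{\varepsilon_j}\}$, such that for every Borel set $E\subset\mathbb{R}^d$ of finite Lebesgue measure and of finite perimeter $$\lim_{j\to\infty}C_{\varepsilon_j}^{-1}\mathrm{Per}_{\nu_{\varepsilon_j}}(E)=\frac12\int_{\mathbb{S}^{d-1}}\int_{\mathbb{R}^d}|D\mathbf{1}_E\cdot\theta|\,\mu(\mathrm{d}\theta).$$ In particular, if $\mu$ is the normalized uniform measure on $\mathbb{S}^{d-1}$, then $$\lim_{j\to\infty}C_{\varepsilon_j}^{-1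}\mathrm{Per}_{\nu_{\varepsilon_j}}(E)=\frac{K_{1,d}}{2\kappa_{d-1}}\,\mathrm{Per}(E).$$
   Context: $a\wedge b=\min(a,b)$ (with $\infty\wedge a=a$). $B_R$ is the closed Euclidean ball of radius $R$ centred at $0$. $(0,\infty)S=\{re: r>0,\ e\in S\}$. For a positive Borel measure $\nu$ on $\mathbb{R}^d$ and a Borel set $E$, $\mathrm{Per}_\nu(E)=\int_E\int_{E^c-x}\nu(\mathrm{d}y)\,\mathrm{d}x=\int_E\nu(E^c-x)\,\mathrm{d}x$. $\mathrm{Per}(E)=|D\mathbf{1}_E|(\mathbb{R}^d)$ is the classical (De Giorgi) perimeter, i.e. the total variation of the distributional gradient of $\mathbf{1}_E$. For $\theta\in\mathbb{S}^{d-1}$, $|D\mathbf{1}_E\cdot\theta|$ is the total variation measure of the scalar signed measure $D\mathbf{1}_E\cdot\theta$, and $\int_{\mathbb{R}^d}|D\mathbf{1}_E\cdot\theta|$ denotes its total mass. $\sigma$ is the surface measure on $\mathbb{S}^{d-1}$, $\kappa_{d-1}=\sigma(\mathbb{S}^{d-1})$, and $K_{1,d}=\int_{\mathbb{S}^{d-1}}|e\cdot\theta|\,\sigma(\mathrm{d}\theta)$ for any unit vector $e$. *)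

theory Defs
  imports "HOL-Probability.Probability"
begin

abbreviation sphere_borel :: "'a::euclidean_space measure" where
  "sphere_borel \<equiv> restrict_space borel (sphere 0 1)"

definition polar_set :: "real set \<Rightarrow> 'a::real_normed_vector set \<Rightarrow> 'a set" where
  "polar_set I S = {r *\<^sub>R e | r e. r \<in> I \<and> e \<in> S}"

definition polar_measure :: "real set \<Rightarrow> 'a::euclidean_space measure \<Rightarrow> 'a measure" where
  "polar_measure I M =
     measure_of (sphere 0 1) (sets sphere_borel) (\<lambda>S. emeasure M (polar_set I S))"

definition angular_measure :: "'a::euclidean_space measure \<Rightarrow> 'a measure" where
  "angular_measure M = polar_measure {0<..} M"

text \<open>The surface measure is the one of polar coordinates: \<open>\<sigma>(S)\<close> is \<open>d\<close> times the
  volume of the cone \<open>(0,1]S\<close>. For \<open>d = 1\<close> it is the counting measure on \<open>{-1, 1}\<close>.\<close>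

definition surface_measure :: "'a::euclidean_space measure" where
  "surface_measure = scale_measure (of_nat DIM('a)) (polar_measure {0<..1} lborel)"

text \<open>The sphere is compact, so the continuous test functions are bounded.\<close>

definition sphere_weak_conv :: "(nat \<Rightarrow> 'a::euclidean_space measure) \<Rightarrow> 'a measure \<Rightarrow> bool" where
  "sphere_weak_conv M \<mu> \<longleftrightarrow>
     (\<forall>f :: 'a \<Rightarrow> real. continuous_on (sphere 0 1) f \<longrightarrow>
        (\<lambda>j. \<integral>\<theta>. f \<theta> \<partial>M j) \<longlonglongrightarrow> (\<integral>\<theta>. f \<theta> \<partial>\<mu>))"

lemma polar_set_alt:
  assumes "I \<subseteq> {0<..}" "S \<subseteq> sphere 0 1"
  shows "polar_set I S = {x. norm x \<in> I \<and> x /\<^sub>R norm x \<in> S}"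
proof (intro set_eqI iffI)
  fix x assume "x \<in> polar_set I S"
  then obtain r e where "x = r *\<^sub>R e" "r \<in> I" "e \<in> S" by (auto simp: polar_set_def)
  moreover have "r > 0" "norm e = 1" using assms \<open>r \<in> I\<close> \<open>e \<in> S\<close> by auto
  ultimately show "x \<in> {x. norm x \<in> I \<and> x /\<^sub>R norm x \<in> S}" by auto
next
  fix x assume x: "x \<in> {x. norm x \<in> I \<and> x /\<^sub>R norm x \<in> S}"
  then have "norm x > 0" using assms by auto
  then have "x = norm x *\<^sub>R (x /\<^sub>R norm x)" by simp
  with x show "x \<in> polar_set I S" unfolding polar_set_def by blast
qed

lemma sets_polar_measure [simp, measurable_cong]:
  "sets (polar_measure I M) = sets sphere_borel"
  unfolding polar_measure_def by (metis sets.sets_measure_of_eq space_restrict_space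
      space_borel Int_UNIV_right)

lemma space_polar_measure [simp]: "space (polar_measure I M) = sphere 0 1"
  using sets_eq_imp_space_eq[OF sets_polar_measure] by (simp add: space_restrict_space)

lemma emeasure_polar_measure:
  fixes M :: "'a::euclidean_space measure"
  assumes M: "sets M = sets borel" and I: "I \<in> sets borel" "I \<subseteq> {0<..}"
    and S: "S \<in> sets sphere_borel"
  shows "emeasure (polar_measure I M) S = emeasure M (polar_set I S)"
proof -
  let ?N = "sphere_borel :: 'a measure"
  have sub: "A \<subseteq> sphere 0 1" "A \<in> sets borel" if "A \<in> sets ?N" for A
    using that by (auto simp: sets_restrict_space)
  have meas: "polar_set I A \<in> sets M" if "A \<in> sets ?N" for A
  proof -
    have [measurable]: "A \<in> sets borel" using sub[OF that] by simp
    note I(1)[measurable]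
    have "{x::'a \<in> space borel. norm x \<in> I \<and> x /\<^sub>R norm x \<in> A} \<in> sets borel"
      by measurable
    then show ?thesis using M polar_set_alt[OF I(2) sub(1)[OF that]] by simp
  qed
  show ?thesis
    unfolding polar_measure_def
  proof (rule emeasure_measure_of[OF refl _ _ _ ])
    show "sets ?N \<subseteq> Pow (sphere 0 1)" using sub by auto
    let ?M = "measure_of (sphere 0 1) (sets ?N) (\<lambda>S. emeasure M (polar_set I S))"
    have eq: "sets ?M = sets ?N" using sets_polar_measure[of I M] by (simp add: polar_measure_def)
    show "S \<in> sets ?M" using S eq by simp
    show "positive (sets ?M) (\<lambda>S. emeasure M (polar_set I S))"
      by (simp add: positive_def polar_set_def)
    show "countably_additive (sets ?M) (\<lambda>S. emeasure M (polar_set I S))"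
      unfolding countably_additive_def eq
    proof (intro allI impI)
      fix A :: "nat \<Rightarrow> 'a set"
      assume A: "range A \<subseteq> sets ?N" "disjoint_family A"
      have alt: "polar_set I (A i) = {x. norm x \<in> I \<and> x /\<^sub>R norm x \<in> A i}" for i
        using A by (intro polar_set_alt I sub) auto
      have "(\<Sum>i. emeasure M (polar_set I (A i))) = emeasure M (\<Union>i. polar_set I (A i))"
      proof (rule suminf_emeasure)
        show "range (\<lambda>i. polar_set I (A i)) \<subseteq> sets M" using A meas by auto
        show "disjoint_family (\<lambda>i. polar_set I (A i))"
          using A(2) unfolding alt disjoint_family_on_def by blast
      qed
      also have "(\<Union>i. polar_set I (A i)) = polar_set I (\<Union>i. A i)"
        by (auto simp: polar_set_def)
      finally show "(\<Sum>i. emeasure M (polar_set I (A i))) = emeasure M (polar_set I (\<Union>i. A i))" .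
    qed
  qed
qed

definition nonlocal_perimeter :: "'a::euclidean_space measure \<Rightarrow> 'a set \<Rightarrow> ennreal" where
  "nonlocal_perimeter \<nu> E =
     (\<integral>\<^sup>+x\<in>E. emeasure \<nu> ((\<lambda>z. z - x) ` (- E)) \<partial>lborel)"

primrec Ck :: "nat \<Rightarrow> ('a::real_normed_vector \<Rightarrow> real) \<Rightarrow> bool" where
  "Ck 0 f \<longleftrightarrow> continuous_on UNIV f"
| "Ck (Suc k) f \<longleftrightarrow>
     (\<forall>x. f differentiable (at x)) \<and> (\<forall>v. Ck k (\<lambda>x. frechet_derivative f (at x) v))"

definition test_function :: "('a::euclidean_space \<Rightarrow> real) \<Rightarrow> bool" where
  "test_function \<phi> \<longleftrightarrow> (\<forall>k. Ck k \<phi>) \<and> (\<exists>K. compact K \<and> (\<forall>x. x \<notin> K \<longrightarrow> \<phi> x = 0))"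

text \<open>Finite signed Borel measures are real set functions that are differences of two finite
  Borel measures \<open>P\<close> and \<open>N\<close>. The integral \<open>\<integral>\<phi> dP - \<integral>\<phi> dN\<close> of a bounded Borel function
  does not depend on the choice of \<open>P\<close> and \<open>N\<close>.\<close>

definition signed_decomp ::
  "('a::euclidean_space set \<Rightarrow> real) \<Rightarrow> 'a measure \<Rightarrow> 'a measure \<Rightarrow> bool" where
  "signed_decomp m P N \<longleftrightarrow>
     finite_measure P \<and> finite_measure N \<and> sets P = sets borel \<and> sets N = sets borel \<and>
     (\<forall>A\<in>sets borel. m A = measure P A - measure N A)"

text \<open>The vector-valued measure \<open>m\<close> is the distributional gradient of the indicator of \<open>E\<close>.
  Only the values of \<open>m\<close> on Borel sets matter, and these are unique.\<close>

definition is_indicator_gradient ::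
  "'a::euclidean_space set \<Rightarrow> ('a set \<Rightarrow> 'a) \<Rightarrow> bool" where
  "is_indicator_gradient E m \<longleftrightarrow>
     (\<forall>b\<in>Basis. \<exists>P N. signed_decomp (\<lambda>A. m A \<bullet> b) P N \<and>
        (\<forall>\<phi>. test_function \<phi> \<longrightarrow>
           (LINT x:E|lborel. frechet_derivative \<phi> (at x) b)
             = - ((\<integral>x. \<phi> x \<partial>P) - (\<integral>x. \<phi> x \<partial>N))))"

definition indicator_gradient :: "'a::euclidean_space set \<Rightarrow> 'a set \<Rightarrow> 'a" where
  "indicator_gradient E = (SOME m. is_indicator_gradient E m)"

definition total_variation ::
  "('a::euclidean_space set \<Rightarrow> 'b::real_normed_vector) \<Rightarrow> 'a set \<Rightarrow> ennreal" where
  "total_variation m B =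
     (SUP A \<in> {A :: nat \<Rightarrow> 'a set. range A \<subseteq> sets borel \<and> disjoint_family A \<and> (\<Union>i. A i) = B}.
        \<Sum>i. ennreal (norm (m (A i))))"

definition perimeter :: "'a::euclidean_space set \<Rightarrow> ennreal" where
  "perimeter E =
     (if \<exists>m. is_indicator_gradient E m then total_variation (indicator_gradient E) UNIV else \<infinity>)"

end

theory Submission
  imports Defs
begin

text \<open>Write \<open>V(\<theta>)\<close> for the mass of \<open>|D1\<^sub>E \<cdot> \<theta>|\<close> and \<open>G(y)\<close> for the volume of the points of \<open>E\<close> that the
  translation by \<open>y\<close> moves out of \<open>E\<close>. By Tonelli, \<open>Per\<^sub>\<nu>(E) = \<integral> G d\<nu>\<close>, so the rescaled perimeter is the
  \<open>\<lambda>\<^sub>\<epsilon>\<close>-integral of \<open>G(y) / (R\<^sub>\<epsilon> \<and> |y|)\<close>. Testing against smooth functions gives \<open>2 G(y) \<le> V(y)\<close> and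
  \<open>2 G(t\<theta>) / t \<longrightarrow> V(\<theta>)\<close> as \<open>t \<longrightarrow> 0+\<close>; since \<open>G\<close> is even and subadditive, these quotients are uniformly
  Lipschitz in \<open>\<theta>\<close>, and the convergence is uniform on the sphere. As \<open>\<lambda>\<^sub>\<epsilon>\<close> concentrates at the origin,
  the integral is asymptotically \<open>\<integral> V d\<mu>\<^sub>\<epsilon> / 2\<close>, and \<open>V\<close> is continuous.
  The weakly convergent subsequence comes from Helly's theorem on the real line, to which the
  measures on the sphere are transported along a section of a space-filling curve.\<close>

subsection \<open>Smooth cut-off functions\<close>

text \<open>Dominating all coordinates by one finite measure \<open>M\<close> yields a vector
  density \<open>\<rho>\<close> with V(v) = \<integral> |\<open>\<rho>\<close> . v| dM and Per(E) =
  \<integral> |\<open>\<rho>\<close>| dM, and questions about V become questions about an integrand.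
  Both estimates on G come from F(s) = integral over E of \<psi>(x + s v) with |\<psi>| \<le> 1. Its
  derivative pairs \<psi> with \<open>\<rho>\<close>, so it is at most V(v); its increment over
  [0, t] is at most 2 G(t v), the volume of the symmetric difference of E and a translate. A \<psi>
  close to a sign makes either bound nearly sharp. The factor 1/2 of the theorem is this 2: as much
  volume enters E as leaves it. Only the lower bound on G needs t to tend to 0, so only there must
  uniformity in the direction be earned.\<close>

lemma Ck_SucI:
  assumes "\<And>x. (f has_derivative D x) (at x)" "\<And>v. Ck k (\<lambda>x. D x v)"
  shows "Ck (Suc k) f"
proof -
  \<comment> \<open>\<open>frechet_derivative\<close> is a choice among derivatives; their
    uniqueness identifies it with the explicit \<open>D\<close>, so concrete functions never have to
    deal with the choice.\<close>
  have "frechet_derivative f (at x) = D x" for x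
    using frechet_derivative_at[OF assms(1)] by simp
  then show ?thesis
    using assms by (auto simp: differentiable_def)
qed

lemma Ck_Suc_has_derivative:
  "Ck (Suc k) f \<Longrightarrow> (f has_derivative frechet_derivative f (at x)) (at x)"
  using frechet_derivative_works by auto

lemma Ck_SucD: "Ck (Suc k) f \<Longrightarrow> Ck k f"
proof (induction k arbitrary: f)
  case 0
  then show ?case
    by (simp add: continuous_on_eq_continuous_at differentiable_imp_continuous_within)
next
  case (Suc k)
  then show ?case by (metis Ck.simps(2))
qed

lemma Ck_const [simp]: "Ck k (\<lambda>_. c)"
proof (induction k arbitrary: c)
  case (Suc k)
  show ?case by (rule Ck_SucI[where D="\<lambda>_ _. 0"]) (use Suc in \<open>auto simp del: Ck.simps\<close>)
qed simp

lemma Ck_add: "Ck k f \<Longrightarrow> Ck k g \<Longrightarrow> Ck k (\<lambda>x. f x + g x)"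
proof (induction k arbitrary: f g)
  case (Suc k)
  show ?case
    by (rule Ck_SucI[OF has_derivative_add[OF Ck_Suc_has_derivative[OF Suc.prems(1)]
            Ck_Suc_has_derivative[OF Suc.prems(2)]]])
      (use Suc in auto)
qed (simp add: continuous_on_add)

lemma Ck_mult: "Ck k f \<Longrightarrow> Ck k g \<Longrightarrow> Ck k (\<lambda>x. f x * g x)"
proof (induction k arbitrary: f g)
  case (Suc k)
  show ?case
    by (rule Ck_SucI[OF has_derivative_mult[OF Ck_Suc_has_derivative[OF Suc.prems(1)]
            Ck_Suc_has_derivative[OF Suc.prems(2)]]])
      (intro Ck_add Suc.IH; use Suc.prems Suc.prems[THEN Ck_SucD] in simp)
qed (simp add: continuous_on_mult)

lemma Ck_cmult: "Ck k f \<Longrightarrow> Ck k (\<lambda>x. c * f x)"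
  by (intro Ck_mult Ck_const)

lemma Ck_diff: "Ck k f \<Longrightarrow> Ck k g \<Longrightarrow> Ck k (\<lambda>x. f x - g x)"
  using Ck_add[of k f "\<lambda>x. (-1) * g x"] Ck_cmult[of k g "-1"] by simp

lemma Ck_prod: "(\<And>i. i \<in> I \<Longrightarrow> Ck k (f i)) \<Longrightarrow> Ck k (\<lambda>x. \<Prod>i\<in>I. f i x)"
  by (induction I rule: infinite_finite_induct) (auto intro: Ck_mult)

text \<open>The derivative in direction \<open>v\<close> is f'(u(x)) times that of \<open>u\<close>.
  The induction generalises \<open>f\<close>, which is replaced by its derivative, while
  \<open>u\<close> stays and only drops one order by \<open>Ck_SucD\<close>.\<close>

lemma Ck_compose:
  fixes f :: "real \<Rightarrow> real"
  shows "Ck k f \<Longrightarrow> Ck k u \<Longrightarrow> Ck k (\<lambda>x. f (u x))"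
proof (induction k arbitrary: f)
  case 0
  then show ?case by (auto intro: continuous_on_compose2)
next
  case (Suc k)
  let ?f' = "\<lambda>t. frechet_derivative f (at t) 1"
  have eq: "frechet_derivative f (at (u x)) (frechet_derivative u (at x) v)
      = frechet_derivative u (at x) v * ?f' (u x)" for x v
  proof -
    have "bounded_linear (frechet_derivative f (at (u x)))"
      using Ck_Suc_has_derivative[OF Suc.prems(1)] by (rule has_derivative_bounded_linear)
    from linear_scale[OF bounded_linear.linear[OF this], of "frechet_derivative u (at x) v" 1]
    show ?thesis by simp
  qed
  have "((\<lambda>x. f (u x)) has_derivative
      (\<lambda>v. frechet_derivative f (at (u x)) (frechet_derivative u (at x) v))) (at x)" for x
  proof -
    have "(u has_derivative frechet_derivative u (at x)) (at x)"
      "(f has_derivative frechet_derivative f (at (u x))) (at (u x))"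
      using Suc.prems by (auto simp: frechet_derivative_works[symmetric])
    then show ?thesis by (rule has_derivative_compose)
  qed
  then show ?case
  proof (rule Ck_SucI)
    fix v
    have "Ck k (\<lambda>x. ?f' (u x))"
      using Suc.prems(1) by (intro Suc.IH[where f="?f'", OF _ Ck_SucD[OF Suc.prems(2)]]) simp
    moreover have "Ck k (\<lambda>x. frechet_derivative u (at x) v)"
      using Suc.prems by simp
    ultimately show "Ck k (\<lambda>x. frechet_derivative f (at (u x)) (frechet_derivative u (at x) v))"
      unfolding eq by (rule Ck_mult[rotated])
  qed
qed

lemma Ck_inverse:
  assumes "\<And>x. u x \<noteq> 0"
  shows "Ck k u \<Longrightarrow> Ck k (\<lambda>x. inverse (u x))"
proof (induction k)
  case 0
  then show ?case using assms by (simp add: continuous_on_inverse)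
next
  case (Suc k)
  note IH = Suc.IH[OF Ck_SucD[OF Suc.prems]]
  show ?case
    by (rule Ck_SucI[OF Deriv.has_derivative_inverse[OF assms Ck_Suc_has_derivative[OF Suc.prems]]])
      (use Suc.prems in \<open>simp add: Ck_mult IH Ck_cmult[where c="-1", simplified]\<close>)
qed

lemma Ck_shift: "Ck k f \<Longrightarrow> Ck k (\<lambda>x. f (x + a))"
proof (induction k arbitrary: f)
  case 0
  then show ?case by (auto intro!: continuous_on_compose2[of UNIV f] continuous_intros)
next
  case (Suc k)
  have "((\<lambda>x. f (x + a)) has_derivative frechet_derivative f (at (x + a))) (at x)" for x
    by (rule has_derivative_compose[where f="\<lambda>x. x + a" and f'="\<lambda>v. v", simplified])
      (use Ck_Suc_has_derivative[OF Suc.prems] in \<open>auto intro!: derivative_eq_intros\<close>)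
  then show ?case by (rule Ck_SucI) (use Suc in auto)
qed

text \<open>\<open>Ck 0\<close> is continuity and has no derivative to exhibit; proving the claim
  one order higher and coming back with \<open>Ck_SucD\<close> treats all \<open>k\<close>
  alike.\<close>

lemma Ck_inner: "Ck k (\<lambda>x::'a::real_inner. x \<bullet> v)"
  by (rule Ck_SucD, rule Ck_SucI[where D="\<lambda>_ h. h \<bullet> v"]) (auto intro!: derivative_eq_intros)

lemma Ck_inner_self: "Ck k (\<lambda>x::'a::real_inner. x \<bullet> x)"
proof (rule Ck_SucD, rule Ck_SucI[where D="\<lambda>x h. 2 * (x \<bullet> h)"])
  show "((\<lambda>x. x \<bullet> x) has_derivative (\<lambda>h. 2 * (x \<bullet> h))) (at x)" for x :: 'a
    by (auto intro!: derivative_eq_intros simp: inner_commute)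
qed (intro Ck_cmult Ck_inner)

text \<open>The flat function exp(-1/t), extended by 0, times powers of 1/t. With the powers the
  family is closed under differentiation up to linear combinations, so smoothness is one induction
  for all \<open>n\<close>.\<close>

definition flat_exp :: "nat \<Rightarrow> real \<Rightarrow> real" where
  "flat_exp n t = (if t > 0 then inverse t ^ n * exp (- inverse t) else 0)"

lemma flat_exp_tendsto_0: "(flat_exp n \<longlongrightarrow> 0) (at 0)"
proof -
  have "(flat_exp n \<longlongrightarrow> 0) (at_left 0)"
    by (rule tendsto_eventually) (auto simp: flat_exp_def eventually_at_filter)
  moreover have "((\<lambda>t::real. inverse t ^ n / exp (inverse t)) \<longlongrightarrow> 0) (at_right 0)"
    using filterlim_compose[OF tendsto_power_div_exp_0 filterlim_inverse_at_top_right] .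
  then have "(flat_exp n \<longlongrightarrow> 0) (at_right 0)"
    by (rule Lim_transform_eventually)
      (auto simp: flat_exp_def eventually_at_filter exp_minus field_simps)
  ultimately show ?thesis by (simp add: filterlim_at_split)
qed

lemma flat_exp_has_derivative:
  "(flat_exp n has_real_derivative flat_exp (n + 2) t - n * flat_exp (n + 1) t) (at t)"
proof -
  consider "t < 0" | "t = 0" | "t > 0" by linarith
  then show ?thesis
  proof cases
    case 1
    have "((\<lambda>_. 0) has_real_derivative 0) (at t)" by simp
    then have "(flat_exp n has_real_derivative 0) (at t)"
      by (rule has_field_derivative_transform_within_open[where S="{..<0}"])
        (use 1 in \<open>auto simp: flat_exp_def\<close>)
    then show ?thesis using 1 by (simp add: flat_exp_def)
  next
    case 2
    \<comment> \<open>As \<open>flat_exp n 0 = 0\<close>, this is the difference quotient at 0, and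
      for h \<noteq> 0 it equals \<open>flat_exp (Suc n) h\<close>.\<close>
    have "((\<lambda>h. flat_exp n h / h) \<longlongrightarrow> 0) (at 0)"
      by (rule Lim_transform_eventually[OF flat_exp_tendsto_0[of "Suc n"]])
        (auto simp: flat_exp_def eventually_at_filter field_simps)
    then show ?thesis using 2 by (simp add: has_field_derivative_iff flat_exp_def)
  next
    case 3
    have "((\<lambda>t. inverse t ^ n * exp (- inverse t)) has_real_derivative
        flat_exp (n + 2) t - n * flat_exp (n + 1) t) (at t)"
    proof (cases n)
      case (Suc m)
      have inv: "(inverse has_real_derivative - (inverse t ^ 2)) (at t)"
        using DERIV_inverse[of t UNIV] 3 by (simp add: power2_eq_square)
      from DERIV_mult[OF DERIV_power_Suc[OF inv, of m] DERIV_chain2[OF DERIV_exp DERIV_minus[OF inv]]]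
      have "((\<lambda>t. inverse t ^ Suc m * exp (- inverse t)) has_real_derivative
          - ((1 + real m) * inverse t ^ m * inverse t ^ 2 * exp (- inverse t))
            + exp (- inverse t) * inverse t ^ 2 * inverse t ^ Suc m) (at t)"
        by (simp add: algebra_simps)
      then show ?thesis
        using 3 unfolding Suc by (simp add: flat_exp_def power2_eq_square algebra_simps)
    qed (use 3 in \<open>auto intro!: derivative_eq_intros simp: flat_exp_def power2_eq_square\<close>)
    then show ?thesis
      by (rule has_field_derivative_transform_within_open[where S="{0<..}"])
        (use 3 in \<open>auto simp: flat_exp_def\<close>)
  qed
qed

lemma Ck_flat_exp: "Ck k (flat_exp n)"
proof (induction k arbitrary: n)
  case 0
  show ?case
    using flat_exp_has_derivative
    by (auto simp: continuous_on_eq_continuous_at intro: DERIV_isCont)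
next
  case (Suc k)
  let ?D = "\<lambda>t. flat_exp (n + 2) t - n * flat_exp (n + 1) t"
  have "Ck k ?D" by (intro Ck_diff Ck_cmult Suc)
  then show ?case
    by (intro Ck_SucI[where D="\<lambda>t v. ?D t * v"])
      (use flat_exp_has_derivative[of n] in
        \<open>auto simp: has_field_derivative_def intro: Ck_mult simp del: Ck.simps\<close>)
qed

text \<open>A smooth transition from 1 on t \<le> 1 to 0 on t \<ge> 2. The denominator never
  vanishes: 2 - t and t - 1 add up to 1, so they cannot both be \<le> 0.\<close>

definition smooth_step :: "real \<Rightarrow> real" where
  "smooth_step t = flat_exp 0 (2 - t) * inverse (flat_exp 0 (2 - t) + flat_exp 0 (t - 1))"

lemma flat_exp_0_sum_pos: "flat_exp 0 (2 - t) + flat_exp 0 (t - 1) > 0"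
  by (auto simp: flat_exp_def add_pos_pos)

lemma smooth_step_range: "0 \<le> smooth_step t" "smooth_step t \<le> 1"
  using flat_exp_0_sum_pos[of t]
  by (auto simp: smooth_step_def flat_exp_def field_simps)

lemma smooth_step_eq_1: "t \<le> 1 \<Longrightarrow> smooth_step t = 1"
  and smooth_step_eq_0: "t \<ge> 2 \<Longrightarrow> smooth_step t = 0"
  by (auto simp: smooth_step_def flat_exp_def)

lemma Ck_id: "Ck k (\<lambda>t::real. t)"
  using Ck_inner[of k "1::real"] by simp

lemma Ck_smooth_step: "Ck k smooth_step"
proof -
  have *: "Ck k (\<lambda>t. flat_exp 0 (2 - t))" "Ck k (\<lambda>t. flat_exp 0 (t - 1))"
    by (rule Ck_compose[OF Ck_flat_exp], intro Ck_diff Ck_const Ck_id)+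
  show ?thesis
    unfolding smooth_step_def[abs_def]
    using * by (intro Ck_mult Ck_inverse Ck_add) (use flat_exp_0_sum_pos less_irrefl in metis)+
qed

text \<open>Finitely many balls cover K with their doubles inside U, and each carries a smooth bump.
  One minus the product of the 1 - b is 1 as soon as one bump is 1, is 0 where all vanish, and,
  unlike a sum, never leaves [0, 1].\<close>

lemma smooth_Urysohn_compact:
  fixes K U :: "'a::euclidean_space set"
  assumes "compact K" "open U" "K \<subseteq> U"
  obtains \<zeta> :: "'a \<Rightarrow> real" where "test_function \<zeta>" "\<And>x. 0 \<le> \<zeta> x" "\<And>x. \<zeta> x \<le> 1"
    "\<And>x. x \<in> K \<Longrightarrow> \<zeta> x = 1" "\<And>x. x \<notin> U \<Longrightarrow> \<zeta> x = 0"
proof -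
  have "\<exists>r>0. cball x (2 * r) \<subseteq> U" if x: "x \<in> K" for x
  proof -
    obtain e where "e > 0" "cball x e \<subseteq> U"
      using assms x open_contains_cball by blast
    then show ?thesis by (intro exI[of _ "e / 2"]) auto
  qed
  then obtain r where r: "\<And>x. x \<in> K \<Longrightarrow> r x > 0" "\<And>x. x \<in> K \<Longrightarrow> cball x (2 * r x) \<subseteq> U"
    by metis
  obtain I where I: "I \<subseteq> K" "finite I" "K \<subseteq> (\<Union>c\<in>I. ball c (r c))"
    by (rule compactE_image[OF assms(1), of K "\<lambda>c. ball c (r c)"]) (use r in auto)
  \<comment> \<open>The squared distance is smooth at the centre, where the norm is not. The bump
    vanishes once the squared distance is at least twice the squared radius, in particular outside
    the doubled ball.\<close>
  define b where "b c x = smooth_step (((x + - c) \<bullet> (x + - c)) * inverse (r c ^ 2))" for c x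
  define \<zeta> where "\<zeta> x = 1 - (\<Prod>c\<in>I. 1 - b c x)" for x
  have b_range: "0 \<le> b c x" "b c x \<le> 1" for c x
    by (simp_all add: b_def smooth_step_range)
  have b1: "b c x = 1" if "c \<in> I" "x \<in> ball c (r c)" for c x
  proof -
    have "norm (x - c) ^ 2 \<le> r c ^ 2"
      using that by (intro power_mono) (auto simp: dist_norm norm_minus_commute)
    moreover have "r c > 0" using that I r by auto
    ultimately show ?thesis
      unfolding b_def by (intro smooth_step_eq_1) (simp add: field_simps dot_square_norm)
  qed
  have b0: "b c x = 0" if "c \<in> I" "x \<notin> cball c (2 * r c)" for c x
  proof -
    have rc: "r c > 0" using that I r by auto
    then have "(2 * r c) ^ 2 \<le> norm (x - c) ^ 2"
      using that by (intro power_mono) (auto simp: dist_norm norm_minus_commute)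
    then have "2 * r c ^ 2 \<le> norm (x - c) ^ 2"
      by (simp add: power_mult_distrib) (use zero_le_power2[of "r c"] in linarith)
    then show ?thesis
      using rc unfolding b_def by (intro smooth_step_eq_0) (simp add: field_simps dot_square_norm)
  qed
  show thesis
  proof (rule that[of \<zeta>])
    have "Ck k (b c)" for k c
      unfolding b_def[abs_def]
      by (intro Ck_compose[OF Ck_smooth_step] Ck_mult Ck_const
          Ck_shift[where f="\<lambda>x. x \<bullet> x"] Ck_inner_self)
    then have "Ck k \<zeta>" for k
      unfolding \<zeta>_def[abs_def] by (intro Ck_diff Ck_const Ck_prod)
    moreover have "\<zeta> x = 0" if "x \<notin> (\<Union>c\<in>I. cball c (2 * r c))" for x
      using that b0 by (auto simp: \<zeta>_def)
    moreover have "compact (\<Union>c\<in>I. cball c (2 * r c))"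
      using I by (intro compact_UN) auto
    ultimately show "test_function \<zeta>" unfolding test_function_def by blast
    show "0 \<le> \<zeta> x" for x
      unfolding \<zeta>_def using b_range by (simp add: prod_le_1)
    show "\<zeta> x \<le> 1" for x
      unfolding \<zeta>_def using b_range by (simp add: prod_nonneg)
    show "\<zeta> x = 1" if x: "x \<in> K" for x
    proof -
      obtain c where "c \<in> I" "x \<in> ball c (r c)" using I x by blast
      then show ?thesis using b1 I by (auto simp: \<zeta>_def intro!: prod_zero)
    qed
    show "\<zeta> x = 0" if "x \<notin> U" for x
    proof -
      have "x \<notin> cball c (2 * r c)" if "c \<in> I" for c
        using that \<open>x \<notin> U\<close> r(2) I(1) by blast
      then show ?thesis using b0 by (simp add: \<zeta>_def)
    qed
  qed
qed

lemma test_function_diff: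
  "test_function f \<Longrightarrow> test_function g \<Longrightarrow> test_function (\<lambda>x. f x - g x)"
proof -
  assume fg: "test_function f" "test_function g"
  then obtain K L where "compact K" "\<And>x. x \<notin> K \<Longrightarrow> f x = 0" "compact L" "\<And>x. x \<notin> L \<Longrightarrow> g x = 0"
    unfolding test_function_def by blast
  then have "compact (K \<union> L)" "\<And>x. x \<notin> K \<union> L \<Longrightarrow> f x - g x = 0"
    by auto
  then show "test_function (\<lambda>x. f x - g x)"
    using fg unfolding test_function_def by (metis Ck_diff)
qed

lemma test_function_continuous: "test_function f \<Longrightarrow> continuous_on UNIV f"
  unfolding test_function_def using Ck.simps(1) by metis

lemma test_function_borel [measurable_dest]: "test_function f \<Longrightarrow> f \<in> borel_measurable borel"
  by (rule borel_measurable_continuous_onI[OF test_function_continuous])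

text \<open>Supplies the nearly optimal test functions for G and for V: a smooth substitute for the
  function that is 1 on A and -1 on B. Inner regularity shrinks A and B to disjoint compact sets,
  and cut-offs living in disjoint neighbourhoods are subtracted.\<close>

lemma test_function_almost_sign:
  fixes Q :: "'a::euclidean_space measure"
  assumes Q: "finite_measure Q" "sets Q = sets borel"
    and AB: "A \<in> sets borel" "B \<in> sets borel" "A \<inter> B = {}" and "\<eta> > 0"
  obtains \<psi> where "test_function \<psi>" "\<And>x. \<bar>\<psi> x\<bar> \<le> 1"
    "(\<integral>x. (indicator A x - indicator B x) * \<psi> x \<partial>Q) \<ge> measure Q (A \<union> B) - \<eta>"
proof -
  interpret finite_measure Q by fact
  \<comment> \<open>Mass left out of a compact set counts twice, since it fails to contribute 1 and
    may contribute -1; with two sets this makes four errors of \<open>\<eta> / 4\<close>.\<close>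
  have inner: "\<exists>K\<subseteq>S. compact K \<and> measure Q K > measure Q S - \<eta> / 4" if "S \<in> sets borel" for S
  proof -
    have "emeasure Q S = (SUP K \<in> {K. K \<subseteq> S \<and> compact K}. emeasure Q K)"
      using that by (intro inner_regular Q) auto
    moreover have "ennreal (measure Q S - \<eta> / 4) < emeasure Q S" if "measure Q S - \<eta> / 4 \<ge> 0"
      using \<open>\<eta> > 0\<close> that unfolding emeasure_eq_measure by (intro ennreal_lessI) auto
    ultimately have "\<exists>K. K \<subseteq> S \<and> compact K \<and> ennreal (measure Q S - \<eta> / 4) < emeasure Q K"
      if "measure Q S - \<eta> / 4 \<ge> 0"
      using that by (simp add: less_SUP_iff)
    then show ?thesis
      by (cases "measure Q S - \<eta> / 4 \<ge> 0")
        (auto simp: emeasure_eq_measure ennreal_less_iff intro!: exI[of _ "{}"])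
  qed
  obtain K where K: "K \<subseteq> A" "compact K" "measure Q K > measure Q A - \<eta> / 4"
    using inner AB by blast
  obtain L where L: "L \<subseteq> B" "compact L" "measure Q L > measure Q B - \<eta> / 4"
    using inner AB by blast
  have KL: "K \<inter> L = {}" using K L AB by auto
  obtain U V where UV: "open U" "open V" "K \<subseteq> U" "L \<subseteq> V" "U \<inter> V = {}"
    by (rule separation_normal_compact[OF K(2) compact_imp_closed[OF L(2)] KL])
  obtain f where f: "test_function f" "\<And>x. 0 \<le> f x" "\<And>x. f x \<le> 1"
    "\<And>x. x \<in> K \<Longrightarrow> f x = 1" "\<And>x. x \<notin> U \<Longrightarrow> f x = 0"
    using smooth_Urysohn_compact[OF K(2) UV(1,3)] by blast
  obtain g where g: "test_function g" "\<And>x. 0 \<le> g x" "\<And>x. g x \<le> 1"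
    "\<And>x. x \<in> L \<Longrightarrow> g x = 1" "\<And>x. x \<notin> V \<Longrightarrow> g x = 0"
    using smooth_Urysohn_compact[OF L(2) UV(2,4)] by blast
  let ?\<psi> = "\<lambda>x. f x - g x"
  have bound: "\<bar>?\<psi> x\<bar> \<le> 1" for x
    using f(2,3)[of x] g(2,3)[of x] by (simp add: abs_le_iff)
  have [measurable]: "A \<in> sets Q" "B \<in> sets Q" "K \<in> sets Q" "L \<in> sets Q"
    using AB K L Q by (auto intro: borel_closed compact_imp_closed)
  have [measurable]: "f \<in> borel_measurable Q" "g \<in> borel_measurable Q"
    using f(1) g(1) Q by (auto simp: measurable_cong_sets[OF Q(2) refl] test_function_borel)
  have sign: "indicator K x + indicator L x - (indicator (A - K) x + indicator (B - L) x)
      \<le> (indicator A x - indicator B x) * ?\<psi> x" for x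
  proof -
    consider "x \<in> K" | "x \<in> L" | "x \<in> A - K" | "x \<in> B - L" | "x \<notin> A" "x \<notin> B" by auto
    then show ?thesis
    proof cases
      case 1
      moreover have "g x = 0" using 1 UV by (intro g(5)) auto
      ultimately show ?thesis using f(4)[of x] K(1) L(1) AB(3) KL by (auto simp: indicator_def)
    next
      case 2
      moreover have "f x = 0" using 2 UV by (intro f(5)) auto
      ultimately show ?thesis using g(4)[of x] K(1) L(1) AB(3) KL by (auto simp: indicator_def)
    next
      case 3
      then have "x \<in> A" "x \<notin> B" "x \<notin> K" "x \<notin> L" using L(1) AB(3) by auto
      then show ?thesis using bound[of x] by (simp add: abs_le_iff)
    next
      case 4
      then have "x \<in> B" "x \<notin> A" "x \<notin> K" "x \<notin> L" using K(1) AB(3) by auto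
      then show ?thesis using bound[of x] by (simp add: abs_le_iff)
    next
      case 5
      then have "x \<notin> K" "x \<notin> L" using K(1) L(1) by auto
      then show ?thesis using 5 by simp
    qed
  qed
  have int: "integrable Q (\<lambda>x. indicator S x :: real)" if "S \<in> sets Q" for S
    using that by (simp add: emeasure_eq_measure)
  have "measure Q (A \<union> B) = measure Q A + measure Q B"
    using AB by (intro finite_measure_Union) auto
  moreover have "measure Q (A - K) = measure Q A - measure Q K" "measure Q (B - L) = measure Q B - measure Q L"
    using K L by (auto intro!: finite_measure_Diff)
  ultimately have "measure Q (A \<union> B) - \<eta>
      \<le> measure Q K + measure Q L - (measure Q (A - K) + measure Q (B - L))"
    using K(3) L(3) by linarith
  also have "\<dots> = (\<integral>x. indicator K x + indicator L x - (indicator (A - K) x + indicator (B - L) x) \<partial>Q)"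
    using int by (subst Bochner_Integration.integral_diff) (auto intro!: integrable_add simp: sets.sets_into_space)
  also have "\<dots> \<le> (\<integral>x. (indicator A x - indicator B x) * ?\<psi> x \<partial>Q)"
  proof (rule integral_mono[OF _ _ sign])
    show "integrable Q (\<lambda>x. (indicator A x - indicator B x) * ?\<psi> x)"
    proof (rule integrable_const_bound[where B=1])
      show "AE x in Q. norm ((indicator A x - indicator B x) * ?\<psi> x) \<le> 1"
        using bound by (auto simp: indicator_def abs_minus_commute)
    qed measurable
  qed (use int in \<open>auto intro!: integrable_add integrable_diff\<close>)
  finally show thesis
    using that[of ?\<psi>] test_function_diff[OF f(1) g(1)] bound by simp
qed

subsection \<open>The gradient measure and its total variation\<close>

text \<open>Serves twice: with the vector density for the perimeter, and with its inner product with
  \<theta> for the directional variation. The upper bound is the triangle inequality on each piece.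
  A countable partition cannot follow the direction of \<open>\<rho>\<close> exactly, so the lower
  bound first carries a factor c < 1.\<close>

lemma total_variation_density:
  fixes M :: "'a::euclidean_space measure" and \<rho> :: "'a \<Rightarrow> 'b::euclidean_space"
  assumes M: "sets M = sets borel" and \<rho>: "integrable M \<rho>"
    and m: "\<And>A. A \<in> sets borel \<Longrightarrow> m A = (LINT x:A|M. \<rho> x)"
  shows "total_variation m UNIV = (\<integral>\<^sup>+x. ennreal (norm (\<rho> x)) \<partial>M)"
proof (rule antisym)
  note M[measurable_cong]
  have [measurable]: "\<rho> \<in> borel_measurable M" using \<rho> by auto
  have int: "integrable M (\<lambda>x. indicator A x *\<^sub>R \<rho> x)" if "A \<in> sets borel" for A
    using that \<rho> M by (intro integrable_mult_indicator) auto
  have split: "(\<integral>\<^sup>+x. f x \<partial>M) = (\<Sum>i. \<integral>\<^sup>+x. f x * indicator (A i) x \<partial>M)"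
    if A: "range A \<subseteq> sets borel" "disjoint_family A" "(\<Union>i. A i) = UNIV"
      and f: "f \<in> borel_measurable M" for f :: "'a \<Rightarrow> ennreal" and A :: "nat \<Rightarrow> 'a set"
  proof -
    note f[measurable]
    have "f x = f x * (\<Sum>i. indicator (A i) x)" for x
      using suminf_indicator[OF A(2)] A(3) by simp
    then have "(\<integral>\<^sup>+x. f x \<partial>M) = (\<integral>\<^sup>+x. (\<Sum>i. f x * indicator (A i) x) \<partial>M)"
      by (intro nn_integral_cong) simp
    also have "\<dots> = (\<Sum>i. \<integral>\<^sup>+x. f x * indicator (A i) x \<partial>M)"
      using A(1) M by (intro nn_integral_suminf) auto
    finally show ?thesis .
  qed
  have norm_m: "ennreal (norm (m A)) \<le> (\<integral>\<^sup>+x. ennreal (norm (\<rho> x)) * indicator A x \<partial>M)"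
    if "A \<in> sets borel" for A
  proof -
    have "ennreal (norm (m A)) \<le> (\<integral>\<^sup>+x. ennreal (norm (indicator A x *\<^sub>R \<rho> x)) \<partial>M)"
      unfolding m[OF that] set_lebesgue_integral_def by (rule integral_norm_bound_ennreal[OF int[OF that]])
    also have "\<dots> = (\<integral>\<^sup>+x. ennreal (norm (\<rho> x)) * indicator A x \<partial>M)"
      by (intro nn_integral_cong) (auto simp: indicator_def)
    finally show ?thesis .
  qed
  show "total_variation m UNIV \<le> (\<integral>\<^sup>+x. ennreal (norm (\<rho> x)) \<partial>M)"
    unfolding total_variation_def
  proof (rule SUP_least)
    fix A :: "nat \<Rightarrow> 'a set"
    assume "A \<in> {A. range A \<subseteq> sets borel \<and> disjoint_family A \<and> (\<Union>i. A i) = UNIV}"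
    then have A: "range A \<subseteq> sets borel" "disjoint_family A" "(\<Union>i. A i) = UNIV" by auto
    show "(\<Sum>i. ennreal (norm (m (A i)))) \<le> (\<integral>\<^sup>+x. ennreal (norm (\<rho> x)) \<partial>M)"
      by (subst split[OF A], simp) (intro suminf_le norm_m, use A in auto)
  qed
  \<comment> \<open>Partition by which of countably many unit vectors \<open>e n\<close> is almost parallel to \<open>\<rho> x\<close>.\<close>
  have lower: "ennreal c * (\<integral>\<^sup>+x. ennreal (norm (\<rho> x)) \<partial>M) \<le> total_variation m UNIV"
    if c: "0 \<le> c" "c < 1" for c
  proof -
    obtain D :: "'b set" where D: "countable D" "\<And>X. open X \<Longrightarrow> X \<noteq> {} \<Longrightarrow> \<exists>d\<in>D. d \<in> X"
      using countable_dense_setE by blast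
    have "D \<noteq> {}" using D(2)[of UNIV] by auto
    \<comment> \<open>\<open>D\<close> may contain 0, which \<open>sgn\<close> leaves at 0; so the
      vectors have norm at most 1, which is all that the final Cauchy-Schwarz step uses.\<close>
    define e where "e n = sgn (from_nat_into D n)" for n
    define S where "S n = {x. c * norm (\<rho> x) \<le> \<rho> x \<bullet> e n}" for n
    have "\<exists>n. c * norm v \<le> v \<bullet> e n" for v :: 'b
    proof (cases "v = 0")
      case False
      let ?X = "{w. c * norm v * norm w < v \<bullet> w}"
      have "open ?X" by (intro open_Collect_less continuous_intros)
      moreover have "c * norm v * norm v < norm v * norm v" using False c by simp
      then have "v \<in> ?X" by (simp add: dot_square_norm power2_eq_square)
      ultimately obtain d where d: "d \<in> D" "d \<in> ?X" using D(2)[of ?X] by blast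
      then obtain n where n: "from_nat_into D n = d"
        using from_nat_into_surj[OF D(1)] by blast
      have "d \<noteq> 0" using d by auto
      then have "c * norm v \<le> v \<bullet> e n"
        using d unfolding e_def n by (simp add: sgn_div_norm field_simps)
      then show ?thesis by blast
    qed auto
    then have cover: "(\<Union>n. S n) = UNIV" by (auto simp: S_def)
    let ?A = "disjointed S"
    have "{x \<in> space M. c * norm (\<rho> x) \<le> \<rho> x \<bullet> e n} \<in> sets M" for n by measurable
    then have S: "S n \<in> sets borel" for n
      using M sets_eq_imp_space_eq[OF M] by (simp add: S_def)
    then have A: "range ?A \<subseteq> sets borel" "disjoint_family ?A" "(\<Union>i. ?A i) = UNIV"
      using cover sets.range_disjointed_sets[of S borel]
      by (auto simp: disjoint_family_disjointed UN_disjointed_eq)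
    have Ai: "?A i \<in> sets borel" for i using A(1) by auto
    have "norm (e i) \<le> 1" for i by (simp add: e_def norm_sgn)
    have "ennreal c * (\<integral>\<^sup>+x. ennreal (norm (\<rho> x)) \<partial>M) = (\<integral>\<^sup>+x. ennreal (c * norm (\<rho> x)) \<partial>M)"
      using c by (simp add: nn_integral_cmult ennreal_mult)
    also have "\<dots> = (\<Sum>i. \<integral>\<^sup>+x. ennreal (c * norm (\<rho> x)) * indicator (?A i) x \<partial>M)"
      by (rule split[OF A]) measurable
    also have "\<dots> \<le> (\<Sum>i. ennreal (norm (m (?A i))))"
    proof (intro suminf_le allI)
      fix i
      have "(\<integral>\<^sup>+x. ennreal (c * norm (\<rho> x)) * indicator (?A i) x \<partial>M)
          = (\<integral>\<^sup>+x. ennreal (c * norm (indicator (?A i) x *\<^sub>R \<rho> x)) \<partial>M)"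
        by (intro nn_integral_cong) (auto simp: indicator_def)
      also have "\<dots> = ennreal (\<integral>x. c * norm (indicator (?A i) x *\<^sub>R \<rho> x) \<partial>M)"
        using int[OF Ai, THEN integrable_norm] c
        by (intro nn_integral_eq_integral integrable_mult_right) auto
      also have "(\<integral>x. c * norm (indicator (?A i) x *\<^sub>R \<rho> x) \<partial>M) \<le> (\<integral>x. (indicator (?A i) x *\<^sub>R \<rho> x) \<bullet> e i \<partial>M)"
      proof (rule integral_mono)
        show "c * norm (indicator (?A i) x *\<^sub>R \<rho> x) \<le> (indicator (?A i) x *\<^sub>R \<rho> x) \<bullet> e i" for x
          using disjointed_subset[of S i] by (auto simp: indicator_def S_def)
      qed (intro integrable_mult_right integrable_norm integrable_inner_left int[OF Ai])+
      also have "\<dots> = m (?A i) \<bullet> e i"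
        unfolding m[OF Ai] set_lebesgue_integral_def by (rule integral_inner_left[OF int[OF Ai]])
      also have "\<dots> \<le> norm (m (?A i)) * norm (e i)" by (rule norm_cauchy_schwarz)
      also have "\<dots> \<le> norm (m (?A i))" using \<open>norm (e i) \<le> 1\<close> by (simp add: mult_left_le)
      finally show "(\<integral>\<^sup>+x. ennreal (c * norm (\<rho> x)) * indicator (?A i) x \<partial>M) \<le> ennreal (norm (m (?A i)))"
        by (simp add: ennreal_leI)
    qed auto
    also have "\<dots> \<le> total_variation m UNIV"
      unfolding total_variation_def using A by (intro SUP_upper) auto
    finally show ?thesis .
  qed
  let ?N = "\<integral>\<^sup>+x. ennreal (norm (\<rho> x)) \<partial>M"
  have "((\<lambda>c. ennreal c * ?N) \<longlongrightarrow> ennreal 1 * ?N) (at_left 1)"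
    using \<rho> by (intro tendsto_mult_ennreal tendsto_intros) (auto simp: integrable_iff_bounded)
  then have "ennreal 1 * ?N \<le> total_variation m UNIV"
  proof (rule tendsto_upperbound)
    show "\<forall>\<^sub>F c in at_left 1. ennreal c * ?N \<le> total_variation m UNIV"
      using eventually_at_left_real[of "0::real" 1] lower by (auto elim!: eventually_mono)
  qed simp
  then show "?N \<le> total_variation m UNIV" by simp
qed

text \<open>The sum dominates every summand; it becomes the common reference measure for all
  coordinates of the gradient.\<close>

lemma emeasure_sum_measures:
  fixes P :: "'i \<Rightarrow> 'a::topological_space measure"
  assumes "\<And>i. i \<in> I \<Longrightarrow> sets (P i) = sets borel" and A: "A \<in> sets borel"
  shows "emeasure (measure_of UNIV (sets borel) (\<lambda>A. \<Sum>i\<in>I. emeasure (P i) A)) A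
    = (\<Sum>i\<in>I. emeasure (P i) A)"
proof (rule emeasure_measure_of[OF refl])
  have sets: "sets (measure_of UNIV (sets borel) (\<lambda>A. \<Sum>i\<in>I. emeasure (P i) A)) = sets (borel :: 'a measure)"
    by (metis sets.sets_measure_of_eq space_borel)
  then show "A \<in> sets (measure_of UNIV (sets borel) (\<lambda>A. \<Sum>i\<in>I. emeasure (P i) A))" using A by simp
  show "positive (sets (measure_of UNIV (sets borel) (\<lambda>A. \<Sum>i\<in>I. emeasure (P i) A))) (\<lambda>A. \<Sum>i\<in>I. emeasure (P i) A)"
    by (simp add: positive_def)
  show "countably_additive (sets (measure_of UNIV (sets borel) (\<lambda>A. \<Sum>i\<in>I. emeasure (P i) A))) (\<lambda>A. \<Sum>i\<in>I. emeasure (P i) A)"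
    unfolding sets countably_additive_def
  proof (intro allI impI)
    fix A :: "nat \<Rightarrow> 'a set" assume A: "range A \<subseteq> sets borel" "disjoint_family A"
    have "(\<Sum>n. \<Sum>i\<in>I. emeasure (P i) (A n)) = (\<Sum>i\<in>I. \<Sum>n. emeasure (P i) (A n))"
      by (rule suminf_sum) simp
    also have "\<dots> = (\<Sum>i\<in>I. emeasure (P i) (\<Union> (range A)))"
      using A assms by (intro sum.cong suminf_emeasure) auto
    finally show "(\<Sum>n. \<Sum>i\<in>I. emeasure (P i) (A n)) = (\<Sum>i\<in>I. emeasure (P i) (\<Union> (range A)))" .
  qed
qed auto

lemma test_function_has_derivative:
  "test_function f \<Longrightarrow> (f has_derivative frechet_derivative f (at x)) (at x)"
  unfolding test_function_def using Ck_Suc_has_derivative by blast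

lemma test_function_frechet_derivative:
  assumes "test_function f"
  shows "test_function (\<lambda>x. frechet_derivative f (at x) v)"
proof -
  obtain K where K: "compact K" "\<And>x. x \<notin> K \<Longrightarrow> f x = 0"
    using assms by (auto simp: test_function_def)
  have "frechet_derivative f (at x) v = 0" if "x \<notin> K" for x
  proof -
    have "((\<lambda>_. 0) has_derivative (\<lambda>_. 0)) (at x)" by simp
    then have "(f has_derivative (\<lambda>_. 0)) (at x)"
      by (rule has_derivative_transform_within_open[where s="- K"])
        (use K that compact_imp_closed in \<open>auto simp: open_Compl\<close>)
    from frechet_derivative_at[OF this] show ?thesis by (metis)
  qed
  moreover have "Ck k (\<lambda>x. frechet_derivative f (at x) v)" for k
    using assms Ck.simps(2) unfolding test_function_def by blast
  ultimately show ?thesis using K(1) unfolding test_function_def by blast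
qed

lemma test_function_bounded:
  assumes "test_function f"
  obtains B where "\<And>x. \<bar>f x\<bar> \<le> B"
proof -
  obtain K where K: "compact K" "\<And>x. x \<notin> K \<Longrightarrow> f x = 0"
    using assms by (auto simp: test_function_def)
  have "compact (f ` K)"
    using K(1) continuous_on_subset[OF test_function_continuous[OF assms]]
    by (intro compact_continuous_image) auto
  then obtain B where "\<And>y. y \<in> f ` K \<Longrightarrow> norm y \<le> B"
    using compact_imp_bounded bounded_iff by metis
  then have "\<bar>f x\<bar> \<le> max B 0" for x
    using K(2)[of x] by (cases "x \<in> K") (auto simp: le_max_iff_disj)
  then show thesis using that by blast
qed

lemma test_function_shift:
  fixes f :: "'a::euclidean_space \<Rightarrow> real"
  assumes "test_function f"
  shows "test_function (\<lambda>x. f (x + a))"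
proof -
  obtain K where K: "compact K" "\<And>x. x \<notin> K \<Longrightarrow> f x = 0"
    using assms by (auto simp: test_function_def)
  have "compact ((\<lambda>x. x - a) ` K)"
    using compact_translation_subtract[OF K(1)] by simp
  moreover have "f (x + a) = 0" if "x \<notin> (\<lambda>x. x - a) ` K" for x
  proof (rule K(2))
    show "x + a \<notin> K" using that by (metis add_diff_cancel image_eqI)
  qed
  ultimately show ?thesis
    using assms unfolding test_function_def by (metis Ck_shift)
qed

text \<open>Every coordinate measure is absolutely continuous with respect to their sum
  \<open>M\<close>, and the Radon-Nikodym densities assemble to a vector field. \<open>P b\<close>
  and \<open>N b\<close> may overlap, so \<open>M\<close> is in general larger than the variation of
  the gradient and |\<open>\<rho>\<close>| is not normalised to 1.\<close>

lemma indicator_gradient_density: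
  fixes E :: "'a::euclidean_space set"
  assumes m: "is_indicator_gradient E m"
    and E: "E \<in> sets borel" "emeasure lborel E < \<infinity>"
  obtains M :: "'a measure" and \<rho> :: "'a \<Rightarrow> 'a" where "finite_measure M" "sets M = sets borel"
    "integrable M \<rho>" "\<And>A. A \<in> sets borel \<Longrightarrow> m A = (LINT x:A|M. \<rho> x)"
    "\<And>\<phi> v. test_function \<phi> \<Longrightarrow>
      (LINT x:E|lborel. frechet_derivative \<phi> (at x) v) = - (\<integral>x. \<phi> x * (\<rho> x \<bullet> v) \<partial>M)"
proof -
  from m obtain P N where PN: "\<And>b. b \<in> Basis \<Longrightarrow> signed_decomp (\<lambda>A. m A \<bullet> b) (P b) (N b)"
    "\<And>b \<phi>. b \<in> Basis \<Longrightarrow> test_function \<phi> \<Longrightarrow> (LINT x:E|lborel. frechet_derivative \<phi> (at x) b)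
             = - ((\<integral>x. \<phi> x \<partial>P b) - (\<integral>x. \<phi> x \<partial>N b))"
    unfolding is_indicator_gradient_def by metis
  \<comment> \<open>A single index set for all these measures: the flag \<open>True\<close> selects
    \<open>P\<close>, the flag \<open>False\<close> selects \<open>N\<close>.\<close>
  define Q where "Q i = (if snd i then P (fst i) else N (fst i))" for i :: "'a \<times> bool"
  define I where "I = (Basis :: 'a set) \<times> (UNIV :: bool set)"
  define M where "M = measure_of UNIV (sets borel) (\<lambda>A. \<Sum>i\<in>I. emeasure (Q i) A)"
  have Q: "finite_measure (Q i)" "sets (Q i) = sets borel" if "i \<in> I" for i
    using PN(1)[of "fst i"] that by (auto simp: Q_def I_def signed_decomp_def)
  have [simp]: "finite I" by (simp add: I_def)
  have sets_M: "sets M = sets borel"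
    unfolding M_def by (metis sets.sets_measure_of_eq space_borel)
  then have space_M: "space M = UNIV" using sets_eq_imp_space_eq by fastforce
  have M: "emeasure M A = (\<Sum>i\<in>I. emeasure (Q i) A)" if "A \<in> sets borel" for A
    unfolding M_def by (rule emeasure_sum_measures[OF Q(2) that])
  have "finite_measure M"
  proof
    have "emeasure (Q i) UNIV \<noteq> \<infinity>" if "i \<in> I" for i
      using finite_measure.emeasure_finite[OF Q(1)[OF that]] by simp
    then show "emeasure M (space M) \<noteq> \<infinity>"
      by (simp add: M space_M)
  qed
  then interpret M: finite_measure M .
  have ex: "\<exists>D. D \<in> borel_measurable M \<and> (\<forall>x. 0 \<le> D x) \<and> Q i = density M (\<lambda>x. ennreal (D x))"
    if i: "i \<in> I" for i
  proof -
    have ac: "absolutely_continuous M (Q i)"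
      unfolding absolutely_continuous_def
    proof
      fix A assume "A \<in> null_sets M"
      then have "A \<in> sets borel" "(\<Sum>i\<in>I. emeasure (Q i) A) = 0"
        using M sets_M by (auto simp: null_sets_def)
      then show "A \<in> null_sets (Q i)"
        using i Q(2)[OF i] by (auto simp: null_sets_def)
    qed
    have sets: "sets (Q i) = sets M" using Q(2)[OF i] sets_M by simp
    obtain D where D: "D \<in> borel_measurable M" "AE x in M. RN_deriv M (Q i) x = ennreal (D x)"
      "\<And>x. 0 \<le> D x"
      using M.real_RN_deriv[OF Q(1)[OF i] ac sets] by metis
    have "Q i = density M (RN_deriv M (Q i))"
      using M.density_RN_deriv[OF ac sets] by simp
    also have "\<dots> = density M (\<lambda>x. ennreal (D x))"
      using D by (intro density_cong) auto
    finally show ?thesis using D by blast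
  qed
  then obtain D where D: "\<And>i. i \<in> I \<Longrightarrow> D i \<in> borel_measurable M" "\<And>i x. i \<in> I \<Longrightarrow> 0 \<le> D i x"
      "\<And>i. i \<in> I \<Longrightarrow> Q i = density M (\<lambda>x. ennreal (D i x))"
    by metis
  have D_int: "integrable M (D i)" if i: "i \<in> I" for i
  proof (rule integrableI_nonneg)
    have "emeasure (Q i) UNIV < \<infinity>"
      using finite_measure.emeasure_finite[OF Q(1)[OF i]] by (simp add: top.not_eq_extremum)
    then show "(\<integral>\<^sup>+x. ennreal (D i x) \<partial>M) < \<infinity>"
      unfolding D(3)[OF i] using D(1)[OF i] space_M sets_M by (simp add: emeasure_density)
  qed (use D i in auto)
  define \<rho> where "\<rho> x = (\<Sum>b\<in>Basis. (D (b, True) x - D (b, False) x) *\<^sub>R b)" for x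
  have bI: "(b, s) \<in> I" if "b \<in> Basis" for b s using that by (simp add: I_def)
  have \<rho>_b: "\<rho> x \<bullet> b = D (b, True) x - D (b, False) x" if "b \<in> Basis" for x b
    using that by (simp add: \<rho>_def inner_sum_left_Basis)
  have \<rho>_int: "integrable M \<rho>"
    unfolding \<rho>_def[abs_def]
    by (intro Bochner_Integration.integrable_sum integrable_scaleR_left
        Bochner_Integration.integrable_diff D_int bI)
  have Q_int: "(\<integral>x. \<phi> x \<partial>Q i) = (\<integral>x. D i x * \<phi> x \<partial>M)" "integrable M (\<lambda>x. D i x * \<phi> x)"
    if i: "i \<in> I" and \<phi>: "\<phi> \<in> borel_measurable borel" "\<And>x. \<bar>\<phi> x\<bar> \<le> B" for i \<phi> B
  proof -
    have meas: "\<phi> \<in> borel_measurable M" using \<phi>(1) measurable_cong_sets[OF sets_M refl] by blast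
    show "(\<integral>x. \<phi> x \<partial>Q i) = (\<integral>x. D i x * \<phi> x \<partial>M)"
      unfolding D(3)[OF i] using D(1,2)[OF i] meas by (subst integral_density) auto
    have "integrable M (\<lambda>x. \<phi> x * D i x)"
    proof (rule Bochner_Integration.integrable_bound[OF integrable_mult_right[OF D_int[OF i], of B]])
      show "AE x in M. norm (\<phi> x * D i x) \<le> norm (B * D i x)"
        using \<phi>(2) D(2)[OF i] by (intro AE_I2) (simp add: abs_mult mult_right_mono order_trans[OF _ abs_ge_self])
    qed (use meas D(1)[OF i] in measurable)
    then show "integrable M (\<lambda>x. D i x * \<phi> x)" by (simp add: mult.commute)
  qed
  have pair: "(\<integral>x. \<phi> x \<partial>P b) - (\<integral>x. \<phi> x \<partial>N b) = (\<integral>x. \<phi> x * (\<rho> x \<bullet> b) \<partial>M)"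
    if b: "b \<in> Basis" and \<phi>: "\<phi> \<in> borel_measurable borel" "\<And>x. \<bar>\<phi> x\<bar> \<le> B" for b \<phi> B
  proof -
    have "(\<integral>x. \<phi> x \<partial>P b) - (\<integral>x. \<phi> x \<partial>N b) = (\<integral>x. D (b, True) x * \<phi> x \<partial>M) - (\<integral>x. D (b, False) x * \<phi> x \<partial>M)"
      using Q_int(1)[OF bI[OF b] \<phi>, of True] Q_int(1)[OF bI[OF b] \<phi>, of False] by (simp add: Q_def)
    also have "\<dots> = (\<integral>x. D (b, True) x * \<phi> x - D (b, False) x * \<phi> x \<partial>M)"
      by (rule Bochner_Integration.integral_diff[symmetric]; rule Q_int(2)[OF bI[OF b] \<phi>])
    finally show ?thesis using b by (simp add: \<rho>_b algebra_simps)
  qed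
  have "m A = (LINT x:A|M. \<rho> x)" if A: "A \<in> sets borel" for A
  proof (rule euclidean_eqI)
    fix b :: 'a assume b: "b \<in> Basis"
    have PNb: "finite_measure (P b)" "finite_measure (N b)" "sets (P b) = sets borel" "sets (N b) = sets borel"
      "m A \<bullet> b = measure (P b) A - measure (N b) A"
      using PN(1)[OF b] A by (auto simp: signed_decomp_def)
    have "m A \<bullet> b = (\<integral>x. indicator A x \<partial>P b) - (\<integral>x. indicator A x \<partial>N b)"
      using PNb A sets_eq_imp_space_eq[OF PNb(3)] sets_eq_imp_space_eq[OF PNb(4)]
      by (simp add: finite_measure.emeasure_finite)
    also have "\<dots> = (\<integral>x. indicator A x * (\<rho> x \<bullet> b) \<partial>M)"
      using A by (intro pair[OF b, of _ 1]) auto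
    also have "\<dots> = (LINT x:A|M. \<rho> x) \<bullet> b"
      unfolding set_lebesgue_integral_def
      using integral_inner_left[OF integrable_mult_indicator[OF _ \<rho>_int, of A], of b] A sets_M
      by (simp add: inner_scaleR_left)
    finally show "m A \<bullet> b = (LINT x:A|M. \<rho> x) \<bullet> b" .
  qed
  moreover have "(LINT x:E|lborel. frechet_derivative \<phi> (at x) v) = - (\<integral>x. \<phi> x * (\<rho> x \<bullet> v) \<partial>M)"
    if \<phi>: "test_function \<phi>" for \<phi> v
  proof -
    let ?d = "\<lambda>b x. frechet_derivative \<phi> (at x) b"
    obtain B where B: "\<And>x. \<bar>\<phi> x\<bar> \<le> B" using test_function_bounded[OF \<phi>] by blast
    have \<phi>M: "\<phi> \<in> borel_measurable M"
      using test_function_borel[OF \<phi>] measurable_cong_sets[OF sets_M refl] by blast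
    have d_int: "set_integrable lborel E (?d b)" for b
    proof -
      note t = test_function_frechet_derivative[OF \<phi>, of b]
      obtain B' where "\<And>x. \<bar>?d b x\<bar> \<le> B'" using test_function_bounded[OF t] by blast
      moreover have "?d b \<in> borel_measurable borel" using test_function_borel[OF t] .
      ultimately show ?thesis
        using E unfolding set_integrable_def
        by (intro integrableI_bounded_set_indicator[where B=B']) auto
    qed
    \<comment> \<open>The gradient is specified on basis vectors only; linearity of the derivative
      carries the formula to every direction \<open>v\<close>.\<close>
    have lin: "?d v x = (\<Sum>b\<in>Basis. (v \<bullet> b) * ?d b x)" for x
    proof -
      have "linear (frechet_derivative \<phi> (at x))"
        using test_function_has_derivative[OF \<phi>] has_derivative_bounded_linear bounded_linear.linear by blast
      then have "(\<Sum>b\<in>Basis. (v \<bullet> b) * ?d b x) = ?d (\<Sum>b\<in>Basis. (v \<bullet> b) *\<^sub>R b) x"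
        by (simp add: linear_sum linear_scale)
      then show ?thesis by (simp add: euclidean_representation)
    qed
    have "(LINT x:E|lborel. ?d v x) = (\<Sum>b\<in>Basis. (v \<bullet> b) * (LINT x:E|lborel. ?d b x))"
      using d_int unfolding lin set_lebesgue_integral_def set_integrable_def
      by (simp add: sum_distrib_left mult.left_commute[of "indicator _ _"])
    also have "\<dots> = (\<Sum>b\<in>Basis. (v \<bullet> b) * (- (\<integral>x. \<phi> x * (\<rho> x \<bullet> b) \<partial>M)))"
      using PN(2)[OF _ \<phi>] pair[OF _ test_function_borel[OF \<phi>] B] by (intro sum.cong) auto
    also have "\<dots> = - (\<integral>x. (\<Sum>b\<in>Basis. (v \<bullet> b) * (\<phi> x * (\<rho> x \<bullet> b))) \<partial>M)"
    proof -
      have "integrable M (\<lambda>x. \<phi> x * (\<rho> x \<bullet> b))" if b: "b \<in> Basis" for b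
        using Bochner_Integration.integrable_diff[OF Q_int(2)[OF bI[OF b] test_function_borel[OF \<phi>] B, of True]
             Q_int(2)[OF bI[OF b] test_function_borel[OF \<phi>] B, of False]]
        by (simp add: \<rho>_b[OF b] algebra_simps)
      then show ?thesis by (simp add: sum_negf)
    qed
    also have "(\<lambda>x. \<Sum>b\<in>Basis. (v \<bullet> b) * (\<phi> x * (\<rho> x \<bullet> b))) = (\<lambda>x. \<phi> x * (\<rho> x \<bullet> v))"
      by (subst euclidean_inner[of "\<rho> _" v]) (simp add: sum_distrib_left mult_ac)
    finally show ?thesis .
  qed
  ultimately show thesis
    using that[of M \<rho>] \<open>finite_measure M\<close> sets_M \<rho>_int by blast
qed

subsection \<open>Weak compactness of probability measures on the sphere\<close>

text \<open>The digits are \<open>\<lfloor>2 ^ Suc k * x\<rfloor> - 2 * \<lfloor>2 ^ k *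
  x\<rfloor>\<close>, and the partial sums telescope to
  \<open>\<lfloor>2 ^ n * x\<rfloor> / 2 ^ n\<close>, starting from
  \<open>\<lfloor>x\<rfloor> = 0\<close>, which is where x < 1 enters.\<close>

lemma binary_digits:
  fixes x :: real
  assumes "0 \<le> x" "x < 1"
  obtains a :: "nat \<Rightarrow> real" where "\<And>k. a k \<in> {0, 1}" "(\<lambda>k. a k / 2 ^ Suc k) sums x"
proof -
  let ?F = "\<lambda>n. \<lfloor>2 ^ n * x\<rfloor>"
  define a where "a k = real_of_int (?F (Suc k) - 2 * ?F k)" for k
  have "a k \<in> {0, 1}" for k
  proof -
    have "real_of_int (?F k) \<le> 2 ^ k * x" "2 ^ k * x < real_of_int (?F k) + 1"
      "real_of_int (?F (Suc k)) \<le> 2 * (2 ^ k * x)" "2 * (2 ^ k * x) < real_of_int (?F (Suc k)) + 1"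
      using floor_correct[of "2 ^ k * x"] floor_correct[of "2 ^ Suc k * x"] by (auto simp: mult.assoc)
    then have "real_of_int (?F (Suc k) - 2 * ?F k) < 2" "real_of_int (?F (Suc k) - 2 * ?F k) > -1"
      unfolding of_int_diff of_int_mult of_int_numeral by linarith+
    then have "?F (Suc k) - 2 * ?F k < 2" "?F (Suc k) - 2 * ?F k > -1" by linarith+
    then have "?F (Suc k) - 2 * ?F k = 0 \<or> ?F (Suc k) - 2 * ?F k = 1" by linarith
    then show ?thesis unfolding a_def by auto
  qed
  moreover have "(\<lambda>k. a k / 2 ^ Suc k) sums x"
  proof -
    have sum: "(\<Sum>k<n. a k / 2 ^ Suc k) = real_of_int (?F n) / 2 ^ n" for n
    proof (induction n)
      case 0
      then show ?case using assms by (simp add: floor_eq_iff)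
    next
      case (Suc n)
      then show ?case by (simp add: a_def field_simps)
    qed
    have "(\<lambda>n. real_of_int (?F n) / 2 ^ n) \<longlonglongrightarrow> x"
    proof (rule real_tendsto_sandwich[of "\<lambda>n. x - (1 / 2) ^ n" _ _ "\<lambda>_. x"])
      have "x - (1 / 2) ^ n \<le> real_of_int (?F n) / 2 ^ n \<and> real_of_int (?F n) / 2 ^ n \<le> x" for n
      proof -
        have "real_of_int (?F n) \<le> 2 ^ n * x" "2 ^ n * x - 1 \<le> real_of_int (?F n)"
          using floor_correct[of "2 ^ n * x"] by auto
        then have "(2 ^ n * x - 1) / 2 ^ n \<le> real_of_int (?F n) / 2 ^ n" "real_of_int (?F n) / 2 ^ n \<le> x"
          by (auto intro: divide_right_mono simp: pos_divide_le_eq mult.commute)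
        moreover have "(2 ^ n * x - 1) / 2 ^ n = x - (1 / 2) ^ n"
          by (simp add: diff_divide_distrib power_divide)
        ultimately show ?thesis by simp
      qed
      then show "\<forall>\<^sub>F n in sequentially. x - (1 / 2) ^ n \<le> real_of_int (?F n) / 2 ^ n"
        "\<forall>\<^sub>F n in sequentially. real_of_int (?F n) / 2 ^ n \<le> x"
        by (auto intro: always_eventually)
      have "(\<lambda>n. x - (1 / 2) ^ n) \<longlonglongrightarrow> x - 0"
        by (intro tendsto_intros LIMSEQ_realpow_zero) auto
      then show "(\<lambda>n. x - (1 / 2) ^ n) \<longlonglongrightarrow> x" by simp
    qed simp
    then show ?thesis unfolding sums_def sum .
  qed
  ultimately show thesis using that by blast
qed

text \<open>Schoenberg's space-filling curve: if all ternary digits of \<open>t\<close> are \<open>0\<close> or \<open>2\<close>, then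
  \<open>read_digit (3 ^ n * t)\<close> is half the \<open>n\<close>-th digit, although \<open>read_digit\<close> is continuous.\<close>

definition read_digit :: "real \<Rightarrow> real" where
  "read_digit t = max 0 (min 1 (1 / 2 - cos (pi * t)))"

lemma read_digit_range: "0 \<le> read_digit t" "read_digit t \<le> 1"
  by (auto simp: read_digit_def)

lemma read_digit_even_shift: "read_digit (t + 2 * real n) = read_digit t"
proof -
  have "cos (pi * (t + 2 * real n)) = cos (pi * t + 2 * real n * pi)"
    by (simp add: algebra_simps)
  also have "\<dots> = cos (pi * t)"
    by (simp add: cos_add)
  finally have "cos (pi * (t + 2 * real n)) = cos (pi * t)" .
  then show ?thesis by (simp add: read_digit_def)
qed

text \<open>Here cos(pi t) \<ge> 1/2 and the clipping at 0 acts; in \<open>read_digit_1\<close> it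
  is \<le> -1/2 and the clipping at 1 acts. These plateaus absorb the digits after the one that is
  read.\<close>

lemma read_digit_0: "0 \<le> t \<Longrightarrow> t \<le> 1 / 3 \<Longrightarrow> read_digit t = 0"
proof -
  assume t: "0 \<le> t" "t \<le> 1 / 3"
  then have "cos (pi / 3) \<le> cos (pi * t)"
    by (intro cos_monotone_0_pi_le) (auto simp: field_simps)
  then show ?thesis by (simp add: read_digit_def cos_60)
qed

lemma read_digit_1: "2 / 3 \<le> t \<Longrightarrow> t \<le> 1 \<Longrightarrow> read_digit t = 1"
proof -
  assume t: "2 / 3 \<le> t" "t \<le> 1"
  then have "cos (pi * t) \<le> cos (2 * pi / 3)"
    by (intro cos_monotone_0_pi_le) (auto simp: field_simps)
  then show ?thesis by (simp add: read_digit_def cos_120)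
qed

text \<open>The witness is the Cantor point with ternary digits 2 a(m). Multiplying by 3 ^ n turns
  the digits before place n into an even integer, removed by the period 2 of
  \<open>read_digit\<close>, and leaves 2 a(n) / 3 plus a tail in [0, 1/3], which stays on a
  plateau.\<close>

lemma read_digits:
  fixes a :: "nat \<Rightarrow> real"
  assumes a: "\<And>n. a n \<in> {0, 1}"
  obtains t where "0 \<le> t" "t \<le> 1" "\<And>n. read_digit (3 ^ n * t) = a n"
proof -
  define c where "c m = 2 * a m / 3 ^ Suc m" for m
  have geo: "(\<lambda>m. 2 / 3 ^ Suc (m + n) :: real) sums (1 / 3 ^ n)" for n
    using sums_mult[OF geometric_sums[of "1 / 3 :: real"], of "2 / 3 ^ Suc n"]
    by (simp add: power_add field_simps)
  have c: "0 \<le> c m" "c m \<le> 2 / 3 ^ Suc m" for m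
    using a[of m] by (auto simp: c_def field_simps)
  have c_sum: "summable (\<lambda>m. c (m + n))" for n
    by (rule summable_comparison_test'[OF sums_summable[OF geo[of n]], of 0])
      (use c in auto)
  have tail: "0 \<le> (\<Sum>m. c (m + n))" "(\<Sum>m. c (m + n)) \<le> 1 / 3 ^ n" for n
    using c suminf_nonneg[OF c_sum] suminf_le[OF _ c_sum sums_summable[OF geo[of n]]] sums_unique[OF geo[of n]]
    by auto
  define t where "t = (\<Sum>m. c m)"
  show thesis
  proof (rule that[of t])
    show "0 \<le> t" "t \<le> 1" using tail[of 0] by (simp_all add: t_def)
    show "read_digit (3 ^ n * t) = a n" for n
    proof -
      have "t = (\<Sum>m. c (m + Suc n)) + (\<Sum>m<Suc n. c m)"
        unfolding t_def using suminf_split_initial_segment[OF c_sum[of 0, simplified], of "Suc n"] by simp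
      then have "3 ^ n * t = 3 ^ n * (\<Sum>m. c (m + Suc n)) + 2 / 3 * a n + 3 ^ n * (\<Sum>m<n. c m)"
        by (simp add: algebra_simps c_def)
      also have "3 ^ n * (\<Sum>m<n. c m) = 2 * real (\<Sum>m<n. nat \<lfloor>a m\<rfloor> * 3 ^ (n - Suc m))"
      proof -
        have "3 ^ n * c m = 2 * real (nat \<lfloor>a m\<rfloor> * 3 ^ (n - Suc m))" if "m < n" for m
        proof -
          have "(3::real) ^ n = 3 ^ Suc m * 3 ^ (n - Suc m)"
            using that by (simp flip: power_add del: power_Suc)
          then show ?thesis using a[of m] by (auto simp: c_def)
        qed
        then show ?thesis by (simp add: sum_distrib_left)
      qed
      finally have eq: "read_digit (3 ^ n * t) = read_digit (3 ^ n * (\<Sum>m. c (m + Suc n)) + 2 / 3 * a n)"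
        by (simp only: read_digit_even_shift)
      have rest: "0 \<le> 3 ^ n * (\<Sum>m. c (m + Suc n))" "3 ^ n * (\<Sum>m. c (m + Suc n)) \<le> 1 / 3"
        using tail[of "Suc n"] by (auto simp: field_simps)
      show ?thesis
      proof (cases "a n = 0")
        case True
        then show ?thesis using rest by (simp only: eq) (simp add: read_digit_0)
      next
        case False
        then have "a n = 1" using a[of n] by auto
        then show ?thesis using rest by (simp only: eq) (simp add: read_digit_1)
      qed
    qed
  qed
qed

text \<open>The digits of the d coordinates are interleaved in a single ternary expansion: place k d
  + i carries the k-th binary digit of coordinate i. The curve need only cover the sphere, not stay
  on it.\<close>

lemma continuous_curve_onto_sphere:
  obtains h :: "real \<Rightarrow> 'a::euclidean_space"
  where "continuous_on UNIV h" "sphere 0 1 \<subseteq> h ` {0..1}"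
proof -
  let ?d = "DIM('a)"
  obtain b :: "nat \<Rightarrow> 'a" where b: "bij_betw b {0..<?d} Basis"
    using ex_bij_betw_nat_finite[OF finite_Basis] by blast
  define g where "g i t = (\<Sum>k. read_digit (3 ^ (k * ?d + i) * t) / 2 ^ Suc k)" for i t
  \<comment> \<open>Each \<open>g i\<close> has values in [0, 1], so the coordinates of
    \<open>h\<close> may range over [-2, 2]. The slack puts (x . b + 2) / 4 strictly below 1 for
    unit vectors x, as \<open>binary_digits\<close> demands.\<close>
  define h where "h t = (\<Sum>i<?d. (4 * g i t - 2) *\<^sub>R b i)" for t
  have half: "(\<lambda>k. 1 / 2 ^ Suc k :: real) sums 1"
    using power_half_series by (simp add: power_divide)
  have cont_g: "continuous_on UNIV (g i)" for i
  proof -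
    have "uniform_limit UNIV (\<lambda>n t. \<Sum>k<n. read_digit (3 ^ (k * ?d + i) * t) / 2 ^ Suc k) (g i) sequentially"
      unfolding g_def
      by (rule Weierstrass_m_test[OF _ sums_summable[OF half]])
        (use read_digit_range in \<open>auto simp: field_simps abs_le_iff intro: order_trans[of _ 0]\<close>)
    then show ?thesis
      by (rule uniform_limit_theorem[rotated])
        (auto intro!: always_eventually continuous_intros simp: read_digit_def)
  qed
  show thesis
  proof (rule that[of h])
    show "continuous_on UNIV h"
      unfolding h_def by (intro continuous_intros cont_g)
    show "sphere 0 1 \<subseteq> h ` {0..1}"
    proof
      fix x :: 'a assume "x \<in> sphere 0 1"
      then have x: "\<bar>x \<bullet> u\<bar> \<le> 1" if "u \<in> Basis" for u
        using Basis_le_norm[OF that, of x] by simp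
      have "\<exists>a. (\<forall>k. a k \<in> {0, 1}) \<and> (\<lambda>k. a k / 2 ^ Suc k :: real) sums ((x \<bullet> b i + 2) / 4)"
        if "i < ?d" for i
      proof -
        have "b i \<in> Basis" using b that by (auto dest: bij_betwE)
        then have "0 \<le> (x \<bullet> b i + 2) / 4" "(x \<bullet> b i + 2) / 4 < 1" using x[of "b i"] by (auto simp: abs_le_iff)
        then show ?thesis using binary_digits by metis
      qed
      then obtain a where a: "\<And>i k. i < ?d \<Longrightarrow> a i k \<in> {0, 1}"
        "\<And>i. i < ?d \<Longrightarrow> (\<lambda>k. a i k / 2 ^ Suc k :: real) sums ((x \<bullet> b i + 2) / 4)"
        by metis
      obtain t where t: "0 \<le> t" "t \<le> 1" "\<And>n. read_digit (3 ^ n * t) = a (n mod ?d) (n div ?d)"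
        by (rule read_digits[of "\<lambda>n. a (n mod ?d) (n div ?d)"]) (use a(1) DIM_positive in auto)
      have g_eq: "g i t = (x \<bullet> b i + 2) / 4" if "i < ?d" for i
      proof -
        have "read_digit (3 ^ (k * ?d + i) * t) = a i k" for k using that by (simp add: t(3))
        then show ?thesis using sums_unique[OF a(2)[OF that]] by (simp add: g_def)
      qed
      have "h t = (\<Sum>i<?d. (x \<bullet> b i) *\<^sub>R b i)"
        unfolding h_def by (intro sum.cong refl) (simp add: g_eq field_simps)
      also have "\<dots> = (\<Sum>u\<in>Basis. (x \<bullet> u) *\<^sub>R u)"
        using sum.reindex_bij_betw[OF b, of "\<lambda>u. (x \<bullet> u) *\<^sub>R u"] by (simp add: atLeast0LessThan)
      also have "\<dots> = x" by (rule euclidean_representation)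
      finally show "x \<in> h ` {0..1}" using t by auto
    qed
  qed
qed

text \<open>The section \<open>s\<close> of the curve \<open>h\<close> is only known to be Borel, so
  weak limits cannot be pushed through it. They need not be: a test function enters on the line as
  f(h(t)), which is continuous, and f(h(s(x))) = f(x) on the sphere.\<close>

lemma sphere_weakly_compact:
  fixes M :: "nat \<Rightarrow> 'a::euclidean_space measure"
  assumes M: "\<And>n. prob_space (M n)" "\<And>n. sets (M n) = sets sphere_borel"
  obtains r \<mu> where "strict_mono r" "prob_space \<mu>" "sets \<mu> = sets sphere_borel"
    "sphere_weak_conv (\<lambda>n. M (r n)) \<mu>"
proof -
  obtain h :: "real \<Rightarrow> 'a" where h: "continuous_on UNIV h" "sphere 0 1 \<subseteq> h ` {0..1}"
    using continuous_curve_onto_sphere by blast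
  \<comment> \<open>The least preimage is Borel, since its sublevel sets are images of compact intervals.\<close>
  define s where "s x = Inf {t \<in> {0..1}. h t = x}" for x
  have space_M: "space (M n) = sphere 0 1" for n
    using sets_eq_imp_space_eq[OF M(2)] by (simp add: space_restrict_space)
  have s: "s x \<in> {0..1}" "h (s x) = x" "\<And>t. t \<in> {0..1} \<Longrightarrow> h t = x \<Longrightarrow> s x \<le> t" if "x \<in> sphere 0 1" for x
  proof -
    let ?T = "{t \<in> {0..1}. h t = x}"
    have "?T \<noteq> {}" using subsetD[OF h(2) that] by auto
    moreover have bdd: "bdd_below ?T" by (rule bdd_belowI[of _ 0]) auto
    moreover have "closed ?T"
    proof -
      have "closed (h -` {x})" using h(1) by (intro closed_vimage) auto
      then have "closed ({0..1} \<inter> h -` {x})" by (intro closed_Int) auto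
      then show ?thesis by (simp add: Int_def vimage_def)
    qed
    ultimately have "s x \<in> ?T" unfolding s_def by (intro closed_contains_Inf)
    then show "s x \<in> {0..1}" "h (s x) = x" by auto
    show "s x \<le> t" if "t \<in> {0..1}" "h t = x" for t
      unfolding s_def using that bdd by (intro cInf_lower) auto
  qed
  have s_meas: "s \<in> borel_measurable sphere_borel"
    unfolding borel_measurable_iff_le
  proof
    fix c
    have "{w \<in> space sphere_borel. s w \<le> c} = sphere 0 1 \<inter> h ` ({0..1} \<inter> {..c})"
    proof (intro set_eqI iffI)
      fix w assume "w \<in> {w \<in> space sphere_borel. s w \<le> c}"
      then have w: "w \<in> sphere 0 1" "s w \<le> c" by (auto simp: space_restrict_space)
      then have "s w \<in> {0..1} \<inter> {..c}" using s(1) by auto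
      then have "h (s w) \<in> h ` ({0..1} \<inter> {..c})" by (rule imageI)
      then show "w \<in> sphere 0 1 \<inter> h ` ({0..1} \<inter> {..c})" using w(1) s(2)[OF w(1)] by simp
    next
      fix w assume w: "w \<in> sphere 0 1 \<inter> h ` ({0..1} \<inter> {..c})"
      then obtain t where "t \<in> {0..1}" "t \<le> c" "h t = w" by auto
      then have "s w \<le> c" using s(3)[of w t] w by auto
      then show "w \<in> {w \<in> space sphere_borel. s w \<le> c}" using w by (simp add: space_restrict_space)
    qed
    moreover have "compact (h ` ({0..1} \<inter> {..c}))"
      using h(1) by (intro compact_continuous_image) (auto intro: continuous_on_subset compact_Int_closed)
    then have "h ` ({0..1} \<inter> {..c}) \<in> sets borel" by (intro borel_closed compact_imp_closed)
    ultimately show "{w \<in> space sphere_borel. s w \<le> c} \<in> sets sphere_borel"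
      by (auto simp: sets_restrict_space)
  qed
  then have s_M: "s \<in> borel_measurable (M n)" for n
    by (simp add: measurable_cong_sets[OF M(2) refl])
  define N where "N n = distr (M n) borel s" for n
  have N: "real_distribution (N n)" for n
    unfolding N_def real_distribution_def real_distribution_axioms_def
    using prob_space.prob_space_distr[OF M(1) s_M] by simp
  have "tight N"
    unfolding tight_def
  proof (intro conjI allI impI N)
    fix \<epsilon> :: real assume "\<epsilon> > 0"
    \<comment> \<open>\<open>tight\<close> uses half-open intervals; starting at -1 keeps the
      possible value s(x) = 0 inside.\<close>
    have "measure (N n) {-1<..1} = 1" for n
    proof -
      have "s -` {-1<..1} \<inter> space (M n) = space (M n)"
        using s(1) by (fastforce simp: space_M)
      then show ?thesis
        unfolding N_def using prob_space.prob_space[OF M(1)] s_M by (simp add: measure_distr)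
    qed
    then show "\<exists>a b. a < b \<and> (\<forall>n. 1 - \<epsilon> < measure (N n) {a<..b})"
      using \<open>\<epsilon> > 0\<close> by (intro exI[of _ "-1"] exI[of _ 1]) auto
  qed
  from tight_imp_convergent_subsubsequence[OF this strict_mono_id]
  obtain r L where r: "strict_mono (r :: nat \<Rightarrow> nat)" and L: "real_distribution L"
    and conv: "weak_conv_m (N \<circ> id \<circ> r) L" by blast
  interpret L: real_distribution L by fact
  have lim: "(\<lambda>n. \<integral>x. f (h (s x)) \<partial>M (r n)) \<longlonglongrightarrow> (\<integral>t. f (h t) \<partial>L)"
    if f: "continuous_on UNIV f" "\<And>x. \<bar>f x\<bar> \<le> B" for f :: "'a \<Rightarrow> real" and B
  proof -
    have fh: "continuous_on UNIV (\<lambda>t. f (h t))"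
      using continuous_on_compose2[OF f(1) h(1)] by simp
    have "(\<lambda>n. integral\<^sup>L ((N \<circ> id \<circ> r) n) (\<lambda>t. f (h t))) \<longlonglongrightarrow> (\<integral>t. f (h t) \<partial>L)"
      using fh f(2) N by (intro weak_conv_imp_integral_bdd_continuous_conv[OF _ L conv, of _ B])
        (auto simp: continuous_on_eq_continuous_at)
    moreover have "integral\<^sup>L ((N \<circ> id \<circ> r) n) (\<lambda>t. f (h t)) = (\<integral>x. f (h (s x)) \<partial>M (r n))" for n
      unfolding comp_def N_def id_def using borel_measurable_continuous_onI[OF fh] s_M
      by (subst integral_distr) auto
    ultimately show ?thesis by simp
  qed
  have h_meas [measurable]: "h \<in> borel_measurable borel" using borel_measurable_continuous_onI[OF h(1)] .
  \<comment> \<open>The curve also runs off the sphere, and \<open>L\<close> might charge such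
    parameters. The bounded continuous function \<open>?g\<close>, zero exactly on the sphere,
    integrates to 0 along the sequence, hence also in the limit.\<close>
  have on_sphere: "AE t in L. norm (h t) = 1"
  proof -
    let ?g = "\<lambda>x::'a. min 1 \<bar>norm x - 1\<bar>"
    have "(\<lambda>n. \<integral>x. ?g (h (s x)) \<partial>M (r n)) \<longlonglongrightarrow> (\<integral>t. ?g (h t) \<partial>L)"
      by (rule lim[of ?g 1]) (auto intro!: continuous_intros)
    moreover have "(\<integral>x. ?g (h (s x)) \<partial>M (r n)) = (\<integral>x. 0 \<partial>M (r n))" for n
      using s(2) by (intro Bochner_Integration.integral_cong) (auto simp: space_M)
    ultimately have "(\<integral>t. ?g (h t) \<partial>L) = 0" by (simp add: LIMSEQ_const_iff)
    moreover have "integrable L (\<lambda>t. ?g (h t))"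
      by (rule L.integrable_const_bound[where B=1]) auto
    ultimately have "AE t in L. ?g (h t) = 0"
      by (subst (asm) integral_nonneg_eq_0_iff_AE) auto
    then show ?thesis by eventually_elim (auto simp: min_def split: if_splits)
  qed
  obtain e :: 'a where e: "norm e = 1" using norm_Basis nonempty_Basis by blast
  \<comment> \<open>Differs from \<open>h\<close> on an \<open>L\<close>-null set only, so that the
    image measure lives on the sphere itself.\<close>
  define p where "p t = (if norm (h t) = 1 then h t else e)" for t
  have p: "p \<in> L \<rightarrow>\<^sub>M sphere_borel"
  proof (rule measurable_restrict_space2)
    show "p \<in> borel_measurable L" unfolding p_def[abs_def] by measurable
  qed (auto simp: p_def e)
  show thesis
  proof (rule that[OF r])
    show "prob_space (distr L sphere_borel p)" by (rule L.prob_space_distr[OF p])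
    show "sphere_weak_conv (\<lambda>n. M (r n)) (distr L sphere_borel p)"
      unfolding sphere_weak_conv_def
    proof (intro allI impI)
      fix f :: "'a \<Rightarrow> real" assume f: "continuous_on (sphere 0 1) f"
      have "compact (f ` sphere 0 1)" by (intro compact_continuous_image f compact_sphere)
      then obtain B where B: "\<And>x. x \<in> sphere 0 1 \<Longrightarrow> norm (f x) \<le> B"
        using compact_imp_bounded bounded_iff by (metis image_eqI)
      have "norm (f e) \<le> B" using B e by simp
      then have "0 \<le> B" using norm_ge_zero order_trans by blast
      \<comment> \<open>\<open>lim\<close> takes test functions on the whole space, since
        \<open>h\<close> leaves the sphere.\<close>
      obtain F where F: "continuous_on UNIV F" "\<And>x. x \<in> sphere 0 1 \<Longrightarrow> F x = f x"
          "\<And>x. x \<in> UNIV \<Longrightarrow> norm (F x) \<le> B"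
        by (rule Tietze[OF f _ \<open>0 \<le> B\<close> B, of UNIV]) auto
      have f_meas: "f \<in> borel_measurable sphere_borel"
        by (rule borel_measurable_continuous_on_restrict[OF f])
      have "(\<lambda>n. \<integral>x. F (h (s x)) \<partial>M (r n)) \<longlonglongrightarrow> (\<integral>t. F (h t) \<partial>L)"
        using F by (intro lim[of F B]) auto
      moreover have "(\<integral>x. F (h (s x)) \<partial>M (r n)) = (\<integral>x. f x \<partial>M (r n))" for n
        using s(2) F(2) by (intro Bochner_Integration.integral_cong) (auto simp: space_M)
      moreover have "(\<integral>t. F (h t) \<partial>L) = (\<integral>t. f (p t) \<partial>L)"
      proof (rule integral_cong_AE)
        show "(\<lambda>t. f (p t)) \<in> borel_measurable L" using measurable_compose[OF p f_meas] .
        show "AE t in L. F (h t) = f (p t)"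
          using on_sphere by eventually_elim (simp add: p_def F(2))
        show "(\<lambda>t. F (h t)) \<in> borel_measurable L"
          using borel_measurable_continuous_onI[OF F(1)] by measurable
      qed
      moreover have "(\<integral>t. f (p t) \<partial>L) = (\<integral>\<theta>. f \<theta> \<partial>distr L sphere_borel p)"
        using p f_meas by (subst integral_distr) auto
      ultimately show "(\<lambda>n. \<integral>\<theta>. f \<theta> \<partial>M (r n)) \<longlonglongrightarrow> (\<integral>\<theta>. f \<theta> \<partial>distr L sphere_borel p)" by simp
    qed
  qed simp
qed

subsection \<open>Polar coordinates and reflections\<close>

text \<open>As for uniqueness of Haar measure: for the translation invariant image measure \<open>N\<close>, Tonelli gives
  \<open>\<lambda>(B) N(A) = N(B) \<lambda>(A)\<close>, and the unit ball \<open>B\<close> has the same mass for both.\<close>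

lemma lborel_distr_reflection:
  fixes T :: "'a::euclidean_space \<Rightarrow> 'a"
  assumes T: "linear T" "\<And>x. T (T x) = x" "\<And>x. norm (T x) = norm x"
  shows "distr lborel borel T = lborel"
proof (rule measure_eqI)
  fix A :: "'a set" assume "A \<in> sets (distr lborel borel T)"
  then have A [measurable]: "A \<in> sets borel" by simp
  let ?N = "distr lborel borel T" and ?B = "ball (0::'a) 1"
  have [measurable]: "T \<in> borel_measurable borel"
    using T(1) by (intro borel_measurable_continuous_onI linear_continuous_on) (simp add: linear_linear)
  have shift: "(\<integral>\<^sup>+y. f (x + y) \<partial>lborel) = (\<integral>\<^sup>+y. f y \<partial>lborel)"
    if "f \<in> borel_measurable borel" for f :: "'a \<Rightarrow> ennreal" and x
  proof -
    have "(\<integral>\<^sup>+y. f y \<partial>lborel) = (\<integral>\<^sup>+y. f y \<partial>distr lborel borel ((+) x))"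
      by (simp add: lborel_distr_plus)
    also have "\<dots> = (\<integral>\<^sup>+y. f (x + y) \<partial>lborel)"
      using that by (subst nn_integral_distr) auto
    finally show ?thesis by simp
  qed
  have reflect: "(\<integral>\<^sup>+y. f (- y) \<partial>lborel) = (\<integral>\<^sup>+y. f y \<partial>lborel)"
    if "f \<in> borel_measurable borel" for f :: "'a \<Rightarrow> ennreal"
  proof -
    have "(\<integral>\<^sup>+y. f y \<partial>lborel) = (\<integral>\<^sup>+y. f y \<partial>distr lborel borel uminus)"
      using lborel_affine[of "-1" "0::'a"] by (simp add: density_1)
    also have "\<dots> = (\<integral>\<^sup>+y. f (- y) \<partial>lborel)"
      using that by (subst nn_integral_distr) auto
    finally show ?thesis by simp
  qed
  have N: "(\<integral>\<^sup>+y. f y \<partial>?N) = (\<integral>\<^sup>+y. f (T y) \<partial>lborel)"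
    if "f \<in> borel_measurable borel" for f :: "'a \<Rightarrow> ennreal"
    using that by (subst nn_integral_distr) auto
  \<comment> \<open>By linearity and T(T x) = x, translating \<open>?N\<close> by x amounts to
    translating Lebesgue measure by T x.\<close>
  have N_shift: "(\<integral>\<^sup>+y. f (y - x) \<partial>?N) = (\<integral>\<^sup>+y. f y \<partial>?N)"
    if [measurable]: "f \<in> borel_measurable borel" for f :: "'a \<Rightarrow> ennreal" and x
  proof -
    have "T y - x = T (- T x + y)" for y
      using T(2) by (simp add: linear_diff[OF T(1)])
    then have "(\<integral>\<^sup>+y. f (y - x) \<partial>?N) = (\<integral>\<^sup>+y. f (T (- T x + y)) \<partial>lborel)"
      by (subst N) simp_all
    also have "\<dots> = (\<integral>\<^sup>+y. f y \<partial>?N)" using shift[of "\<lambda>y. f (T y)" "- T x"] by (simp add: N)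
    finally show ?thesis .
  qed
  interpret N: sigma_finite_measure ?N
  proof (rule sigma_finite_measure.intro[OF exI[where x="range (\<lambda>n. ball (0::'a) (real n))"]], intro conjI ballI)
    show "\<Union> (range (\<lambda>n. ball (0::'a) (real n))) = space ?N"
      using reals_Archimedean2 by auto
    show "emeasure ?N a \<noteq> \<infinity>" if a: "a \<in> range (\<lambda>n. ball (0::'a) (real n))" for a
    proof -
      obtain n :: nat where n: "a = ball 0 (real n)" using a by auto
      have "T -` a \<inter> space lborel = ball 0 (real n)" using T(3) by (auto simp: n)
      then show ?thesis
        using emeasure_lborel_ball_finite[of "0::'a" "real n"]
        by (subst emeasure_distr) (auto simp: n simp del: emeasure_lborel_ball_finite)
    qed
  qed auto
  interpret P: pair_sigma_finite lborel ?N ..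
  let ?f = "\<lambda>x::'a. indicator ?B x :: ennreal" and ?g = "\<lambda>x::'a. indicator A x :: ennreal"
  have [measurable]: "?B \<in> sets borel" by simp
  have [measurable]: "(\<lambda>(x, y). ?f x * ?g (y - x)) \<in> borel_measurable (lborel \<Otimes>\<^sub>M ?N)"
    "(\<lambda>(x, y). ?f (y - x) * ?g x) \<in> borel_measurable (lborel \<Otimes>\<^sub>M ?N)"
  proof -
    have sets: "sets (lborel \<Otimes>\<^sub>M ?N) = sets (borel \<Otimes>\<^sub>M borel)"
      by (intro sets_pair_measure_cong) auto
    have "(\<lambda>(x, y). ?f x * ?g (y - x)) \<in> borel_measurable (borel \<Otimes>\<^sub>M borel)"
      "(\<lambda>(x, y). ?f (y - x) * ?g x) \<in> borel_measurable (borel \<Otimes>\<^sub>M borel)" by measurable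
    then show "(\<lambda>(x, y). ?f x * ?g (y - x)) \<in> borel_measurable (lborel \<Otimes>\<^sub>M ?N)"
      "(\<lambda>(x, y). ?f (y - x) * ?g x) \<in> borel_measurable (lborel \<Otimes>\<^sub>M ?N)"
      by (simp_all add: measurable_cong_sets[OF sets refl])
  qed
  have "emeasure lborel ?B * emeasure ?N A = (\<integral>\<^sup>+x. ?f x * emeasure ?N A \<partial>lborel)"
    by (subst nn_integral_multc) (auto intro: borel_measurable_indicator)
  also have "\<dots> = (\<integral>\<^sup>+x. (\<integral>\<^sup>+y. ?f x * ?g (y - x) \<partial>?N) \<partial>lborel)"
    by (intro nn_integral_cong) (simp add: nn_integral_cmult N_shift[of ?g])
  also have "\<dots> = (\<integral>\<^sup>+y. (\<integral>\<^sup>+x. ?f x * ?g (y - x) \<partial>lborel) \<partial>?N)"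
    by (rule P.Fubini'[symmetric]) measurable
  also have "\<dots> = (\<integral>\<^sup>+y. (\<integral>\<^sup>+x. ?f (y - x) * ?g x \<partial>lborel) \<partial>?N)"
  proof (rule nn_integral_cong)
    \<comment> \<open>Replacing x by y - x, a reflection followed by a translation, moves the
      difference from A to the ball, where the invariance of \<open>?N\<close> can be applied a
      second time.\<close>
    fix y :: 'a
    have "(\<integral>\<^sup>+x. ?f x * ?g (y - x) \<partial>lborel) = (\<integral>\<^sup>+x. ?f (y + x) * ?g (y - (y + x)) \<partial>lborel)"
      by (rule shift[symmetric]) measurable
    also have "\<dots> = (\<integral>\<^sup>+x. ?f (y + - x) * ?g (y - (y + - x)) \<partial>lborel)"
      by (rule reflect[symmetric]) measurable
    finally show "(\<integral>\<^sup>+x. ?f x * ?g (y - x) \<partial>lborel) = (\<integral>\<^sup>+x. ?f (y - x) * ?g x \<partial>lborel)"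
      by simp
  qed
  also have "\<dots> = (\<integral>\<^sup>+x. (\<integral>\<^sup>+y. ?f (y - x) * ?g x \<partial>?N) \<partial>lborel)"
    by (rule P.Fubini') measurable
  also have "\<dots> = (\<integral>\<^sup>+x. emeasure ?N ?B * ?g x \<partial>lborel)"
    by (intro nn_integral_cong) (simp add: nn_integral_multc N_shift[of ?f])
  also have "\<dots> = emeasure ?N ?B * emeasure lborel A"
    by (simp add: nn_integral_cmult)
  also have "emeasure ?N ?B = emeasure lborel ?B"
  proof -
    have "T -` ?B \<inter> space lborel = ?B" using T(3) by auto
    then show ?thesis by (subst emeasure_distr) auto
  qed
  finally show "emeasure ?N A = emeasure lborel A"
    using emeasure_lborel_ball_finite[of "0::'a" 1] content_ball_pos[of 1 "0::'a"]
    by (subst (asm) ennreal_mult_cancel_left) (auto simp: measure_def less_top)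
qed simp

lemma measurable_normalize:
  fixes M :: "'a::euclidean_space measure"
  assumes M: "sets M = sets borel" and I: "I \<subseteq> {0<..}"
  shows "(\<lambda>x. x /\<^sub>R norm x) \<in> restrict_space M {x. norm x \<in> I} \<rightarrow>\<^sub>M sphere_borel"
proof -
  note M[measurable_cong]
  show ?thesis
    using I by (intro measurable_restrict_space2 measurable_restrict_space1) (auto simp: space_restrict_space)
qed

text \<open>As an image under radial projection the measure admits the usual change of variables.
  Restricting to norms in \<open>I\<close> also excludes the origin, which the projection would send
  to 0, off the sphere.\<close>

lemma polar_measure_eq_distr:
  fixes M :: "'a::euclidean_space measure"
  assumes M: "sets M = sets borel" and I: "I \<in> sets borel" "I \<subseteq> {0<..}"
  shows "polar_measure I M =
    distr (restrict_space M {x. norm x \<in> I}) sphere_borel (\<lambda>x. x /\<^sub>R norm x)"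
proof (rule measure_eqI)
  note M[measurable_cong] I(1)[measurable]
  have space_M: "space M = UNIV" using sets_eq_imp_space_eq[OF M] by simp
  have "{x \<in> space M. norm x \<in> I} \<in> sets M" by measurable
  then have S: "{x. norm x \<in> I} \<in> sets M" by (simp add: space_M)
  note * = measurable_normalize[OF M I(2)]
  fix A :: "'a set" assume A: "A \<in> sets (polar_measure I M)"
  then have A': "A \<in> sets sphere_borel" by simp
  then have sub: "A \<subseteq> sphere 0 1" by (auto simp: sets_restrict_space)
  have "emeasure (distr (restrict_space M {x. norm x \<in> I}) sphere_borel (\<lambda>x. x /\<^sub>R norm x)) A
      = emeasure M (polar_set I A)"
    using S A' by (subst emeasure_distr[OF * A'], subst emeasure_restrict_space)
      (auto simp: space_restrict_space space_M polar_set_alt[OF I(2) sub] intro!: arg_cong[where f="emeasure M"])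
  then show "emeasure (polar_measure I M) A =
      emeasure (distr (restrict_space M {x. norm x \<in> I}) sphere_borel (\<lambda>x. x /\<^sub>R norm x)) A"
    using emeasure_polar_measure[OF M I A'] by simp
qed simp

lemma nn_integral_polar_measure:
  fixes M :: "'a::euclidean_space measure"
  assumes M: "sets M = sets borel" and I: "I \<in> sets borel" "I \<subseteq> {0<..}"
    and f: "f \<in> borel_measurable sphere_borel"
  shows "(\<integral>\<^sup>+\<theta>. f \<theta> \<partial>polar_measure I M) = (\<integral>\<^sup>+x. f (x /\<^sub>R norm x) * indicator I (norm x) \<partial>M)"
proof -
  note M[measurable_cong] I(1)[measurable]
  have space_M: "space M = UNIV" using sets_eq_imp_space_eq[OF M] by simp
  have "{x \<in> space M. norm x \<in> I} \<in> sets M" by measurable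
  then have S: "{x. norm x \<in> I} \<in> sets M" by (simp add: space_M)
  show ?thesis
    unfolding polar_measure_eq_distr[OF assms(1-3)]
    using S by (subst nn_integral_distr[OF measurable_normalize[OF M I(2)]], use f in simp, subst nn_integral_restrict_space)
      (auto simp: space_M indicator_def intro!: nn_integral_cong)
qed

lemma nn_integral_surface_measure:
  fixes f :: "'a::euclidean_space \<Rightarrow> ennreal"
  assumes "f \<in> borel_measurable sphere_borel"
  shows "(\<integral>\<^sup>+\<theta>. f \<theta> \<partial>surface_measure)
    = of_nat DIM('a) * (\<integral>\<^sup>+x. f (x /\<^sub>R norm x) * indicator {0<..1} (norm x) \<partial>lborel)"
  unfolding surface_measure_def using assms
  by (subst nn_integral_scale_measure) (auto intro!: arg_cong2[where f=times] nn_integral_polar_measure)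

lemma surface_abs_inner_eq:
  fixes e e' :: "'a::euclidean_space"
  assumes "norm e = 1" "norm e' = 1"
  shows "(\<integral>\<^sup>+\<theta>. ennreal \<bar>e \<bullet> \<theta>\<bar> \<partial>surface_measure) = (\<integral>\<^sup>+\<theta>. ennreal \<bar>e' \<bullet> \<theta>\<bar> \<partial>surface_measure)"
proof -
  \<comment> \<open>The reflection exchanging \<open>e\<close> and \<open>e'\<close>; it is the identity if \<open>e = e'\<close>, as then \<open>x / 0 = 0\<close>.\<close>
  define u where "u = e - e'"
  define T where "T x = x - (2 * (x \<bullet> u) / (u \<bullet> u)) *\<^sub>R u" for x
  have lin: "linear T"
    by (rule linearI) (auto simp: T_def inner_add_left algebra_simps add_divide_distrib)
  have inner: "T x \<bullet> T y = x \<bullet> y" for x y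
    by (cases "u = 0") (simp_all add: T_def inner_diff_left inner_diff_right field_simps inner_commute)
  have inv: "T (T x) = x" for x
    by (cases "u = 0") (simp_all add: T_def inner_diff_left field_simps scaleR_left_diff_distrib flip: scaleR_add_left)
  have Te: "T e = e'"
  proof (cases "u = 0")
    case False
    have "e \<bullet> e = 1" "e' \<bullet> e' = 1" using assms by (simp_all add: dot_square_norm)
    then have "u \<bullet> u = 2 * (e \<bullet> u)" by (simp add: u_def inner_diff_left inner_diff_right inner_commute)
    moreover have "u \<bullet> u \<noteq> 0" using False by simp
    ultimately have "2 * (e \<bullet> u) / (u \<bullet> u) = 1" by (metis div_self)
    then have "T e = e - 1 *\<^sub>R u" by (simp only: T_def)
    then show ?thesis by (simp add: u_def)
  qed (simp add: T_def u_def)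
  have norm: "norm (T x) = norm x" for x using inner[of x x] by (simp add: norm_eq_sqrt_inner)
  have T_meas: "T \<in> borel_measurable borel"
    using lin by (intro borel_measurable_continuous_onI linear_continuous_on) (simp add: linear_linear)
  have meas: "(\<lambda>\<theta>. ennreal \<bar>v \<bullet> \<theta>\<bar>) \<in> borel_measurable sphere_borel" for v :: 'a
    by (rule measurable_restrict_space1) measurable
  let ?h = "\<lambda>v x. ennreal \<bar>v \<bullet> (x /\<^sub>R norm x)\<bar> * indicator {0<..1} (norm x)"
  have "(\<integral>\<^sup>+x. ?h e' x \<partial>lborel) = (\<integral>\<^sup>+x. ?h e' x \<partial>distr lborel borel T)"
    by (simp add: lborel_distr_reflection[OF lin inv norm])
  also have "\<dots> = (\<integral>\<^sup>+x. ?h e' (T x) \<partial>lborel)"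
    using T_meas by (subst nn_integral_distr) auto
  also have "\<dots> = (\<integral>\<^sup>+x. ?h e x \<partial>lborel)"
    using inner[of e] by (simp add: norm Te)
  finally show ?thesis
    by (simp add: nn_integral_surface_measure[OF meas])
qed

subsection \<open>Translates of a set of finite perimeter\<close>

lemma emeasure_shift:
  fixes a :: "'a::euclidean_space"
  assumes "S \<in> sets borel"
  shows "emeasure lborel {x. x + a \<in> S} = emeasure lborel S"
proof -
  have "emeasure lborel S = emeasure (distr lborel borel ((+) a)) S"
    using lborel_distr_plus[of a] by simp
  also have "\<dots> = emeasure lborel {x. x + a \<in> S}"
    using assms by (subst emeasure_distr) (auto simp: vimage_def add.commute)
  finally show ?thesis by simp
qed

lemma measure_shift:
  fixes a :: "'a::euclidean_space"
  shows "S \<in> sets borel \<Longrightarrow> measure lborel {x. x + a \<in> S} = measure lborel S"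
  by (simp add: measure_def emeasure_shift)

text \<open>The set function of the gradient is replaced by any pair \<open>M\<close>,
  \<open>\<rho>\<close> that represents it in the integration by parts.\<close>

locale finite_perimeter =
  fixes E :: "'a::euclidean_space set" and M :: "'a measure" and \<rho> :: "'a \<Rightarrow> 'a"
  assumes E [measurable]: "E \<in> sets borel" and E_finite: "emeasure lborel E < \<infinity>"
    and M_finite: "finite_measure M" and sets_M [measurable_cong]: "sets M = sets borel"
    and \<rho>_integrable: "integrable M \<rho>"
    and by_parts: "\<And>\<phi> v. test_function \<phi> \<Longrightarrow>
      (LINT x:E|lborel. frechet_derivative \<phi> (at x) v) = - (\<integral>x. \<phi> x * (\<rho> x \<bullet> v) \<partial>M)"
begin

text \<open>The V of the overview, for all vectors and not only unit ones: by homogeneity V(t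
  \<theta>) already contains the factor t against which \<open>exit_volume\<close>, the G of the
  overview, is compared.\<close>

definition directional_variation :: "'a \<Rightarrow> real" where
  "directional_variation v = (\<integral>x. \<bar>\<rho> x \<bullet> v\<bar> \<partial>M)"

definition exit_volume :: "'a \<Rightarrow> real" where
  "exit_volume y = measure lborel {x \<in> E. x + y \<notin> E}"

lemma integrable_\<rho>_inner: "integrable M (\<lambda>x. \<rho> x \<bullet> v)"
  using \<rho>_integrable by (rule integrable_inner_left)

lemma \<rho>_borel [measurable]: "\<rho> \<in> borel_measurable M"
  using \<rho>_integrable by simp

lemma directional_variation_nonneg: "0 \<le> directional_variation v"
  by (simp add: directional_variation_def)

lemma directional_variation_scale: "directional_variation (c *\<^sub>R v) = \<bar>c\<bar> * directional_variation v"
  by (simp add: directional_variation_def abs_mult)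

lemma directional_variation_le_add:
  "directional_variation (v + w) \<le> directional_variation v + directional_variation w"
proof -
  have "directional_variation (v + w) \<le> (\<integral>x. \<bar>\<rho> x \<bullet> v\<bar> + \<bar>\<rho> x \<bullet> w\<bar> \<partial>M)"
    unfolding directional_variation_def
    by (intro integral_mono integrable_abs integrable_\<rho>_inner Bochner_Integration.integrable_add)
      (simp add: inner_add_right)
  then show ?thesis
    by (simp add: directional_variation_def integrable_\<rho>_inner)
qed

lemma directional_variation_le: "directional_variation v \<le> (\<integral>x. norm (\<rho> x) \<partial>M) * norm v"
proof -
  have "directional_variation v \<le> (\<integral>x. norm (\<rho> x) * norm v \<partial>M)"
    unfolding directional_variation_def
    by (intro integral_mono integrable_abs integrable_\<rho>_inner integrable_mult_left integrable_norm \<rho>_integrable)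
      (simp add: Cauchy_Schwarz_ineq2)
  then show ?thesis by simp
qed

lemma exit_volume_nonneg: "0 \<le> exit_volume y"
  by (simp add: exit_volume_def)

lemma borel_exit [measurable]: "{x \<in> E. x + y \<notin> E} \<in> sets borel"
  using sets.Diff[OF E, of "{x. x + y \<in> E}"] by (simp add: Diff_eq Int_def)

lemma exit_volume_le: "exit_volume y \<le> measure lborel E"
  unfolding exit_volume_def using E_finite by (intro measure_mono_fmeasurable) (auto simp: fmeasurable_def)

lemma fmeasurable_shift: "{x. x + y \<in> E} \<in> fmeasurable lborel"
  using E_finite emeasure_shift[OF E, of y] by (auto simp: fmeasurable_def)

lemma fmeasurable_E: "E \<in> fmeasurable lborel"
  using fmeasurable_shift[of 0] by simp

lemma fmeasurable_exit: "{x \<in> E. x + y \<notin> E} \<in> fmeasurable lborel"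
  by (rule fmeasurableI2[OF fmeasurable_E]) auto

text \<open>E and its translate have the same finite volume, so removing their intersection leaves
  equal volumes. This symmetry is the source of the factor 2 in all comparisons of G with V.\<close>

lemma enter_volume: "measure lborel {x. x + y \<in> E \<and> x \<notin> E} = exit_volume y"
proof -
  let ?S = "{x. x + y \<in> E}"
  have 1: "?S - E = {x. x + y \<in> E \<and> x \<notin> E}" "E - ?S = {x \<in> E. x + y \<notin> E}" by auto
  have "measure lborel (?S - E) = measure lborel ?S - measure lborel (?S \<inter> E)"
    "measure lborel (E - ?S) = measure lborel E - measure lborel (?S \<inter> E)"
    using measure_Un2[OF fmeasurable_E fmeasurable_shift] measure_Un2[OF fmeasurable_shift fmeasurable_E]
      measure_Un3[OF fmeasurable_E fmeasurable_shift] by (auto simp: Int_commute Un_commute)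
  then show ?thesis
    unfolding 1 exit_volume_def using measure_shift[OF E, of y] by simp
qed

lemma exit_volume_minus: "exit_volume (- y) = exit_volume y"
proof -
  have "exit_volume (- y) = measure lborel {x. x + y \<in> {x \<in> E. x + (- y) \<notin> E}}"
    unfolding exit_volume_def by (rule measure_shift[symmetric]) (rule borel_exit)
  then show ?thesis using enter_volume by simp
qed

text \<open>A point moved out of E by y + z is either moved out by y already, or lands in E and is
  then moved out by z.\<close>

lemma exit_volume_add: "exit_volume (y + z) \<le> exit_volume y + exit_volume z"
proof -
  let ?Z = "{x \<in> E. x + z \<notin> E}"
  have meas: "{x. x + y \<in> ?Z} \<in> sets borel" by measurable
  have fin: "{x. x + y \<in> ?Z} \<in> fmeasurable lborel"
    using emeasure_shift[OF borel_exit, of y z] fmeasurable_exit[of z] meas by (auto simp: fmeasurable_def)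
  have "exit_volume (y + z) \<le> measure lborel ({x \<in> E. x + y \<notin> E} \<union> {x. x + y \<in> ?Z})"
    unfolding exit_volume_def
    by (intro measure_mono_fmeasurable fmeasurable.Un fmeasurable_exit fin) (auto simp: add.assoc)
  also have "\<dots> \<le> exit_volume y + measure lborel {x. x + y \<in> ?Z}"
    unfolding exit_volume_def
    by (intro measure_Un_le) (use borel_exit meas in auto)
  also have "measure lborel {x. x + y \<in> ?Z} = exit_volume z"
    unfolding exit_volume_def by (rule measure_shift[OF borel_exit])
  finally show ?thesis .
qed

section \<open>Integrals of translated test functions over E\<close>

lemma set_integrable_E:
  fixes f :: "'a \<Rightarrow> real"
  assumes "f \<in> borel_measurable borel" "\<And>x. \<bar>f x\<bar> \<le> B"
  shows "set_integrable lborel E f"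
  using assms E_finite unfolding set_integrable_def
  by (intro integrableI_bounded_set_indicator[where B=B]) auto

text \<open>Differentiation under the integral sign, then integration by parts. The derivative of a
  test function is bounded, so the difference quotients are dominated by a constant on E, which has
  finite volume.\<close>

lemma has_derivative_translated_integral_0:
  assumes \<psi>: "test_function \<psi>"
  shows "((\<lambda>s. LINT x:E|lborel. \<psi> (x + s *\<^sub>R v)) has_real_derivative
    - (\<integral>x. \<psi> x * (\<rho> x \<bullet> v) \<partial>M)) (at 0)"
proof -
  let ?d = "\<lambda>x. frechet_derivative \<psi> (at x) v"
  note d = test_function_frechet_derivative[OF \<psi>, of v]
  obtain B where B: "\<And>x. \<bar>?d x\<bar> \<le> B" using test_function_bounded[OF d] by blast
  obtain B0 where B0: "\<And>x. \<bar>\<psi> x\<bar> \<le> B0" using test_function_bounded[OF \<psi>] by blast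
  have [measurable]: "\<psi> \<in> borel_measurable borel" "?d \<in> borel_measurable borel"
    using test_function_borel \<psi> d by auto
  have der: "((\<lambda>s. \<psi> (x + s *\<^sub>R v)) has_real_derivative ?d (x + s *\<^sub>R v)) (at s)" for x s
  proof -
    have "((\<lambda>s. \<psi> (x + s *\<^sub>R v)) has_derivative
        (\<lambda>h. frechet_derivative \<psi> (at (x + s *\<^sub>R v)) (h *\<^sub>R v))) (at s)"
      by (rule has_derivative_compose[OF _ test_function_has_derivative[OF \<psi>]])
        (auto intro!: derivative_eq_intros)
    moreover have "frechet_derivative \<psi> (at (x + s *\<^sub>R v)) (h *\<^sub>R v) = ?d (x + s *\<^sub>R v) * h" for h
      using linear_scale[OF bounded_linear.linear[OF has_derivative_bounded_linear[OF
          test_function_has_derivative[OF \<psi>, of "x + s *\<^sub>R v"]]]] by simp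
    ultimately show ?thesis by (simp add: has_field_derivative_def)
  qed
  have lip: "\<bar>\<psi> (x + h *\<^sub>R v) - \<psi> x\<bar> \<le> B * \<bar>h\<bar>" for x h
    using field_differentiable_bound[of UNIV "\<lambda>s. \<psi> (x + s *\<^sub>R v)" "\<lambda>s. ?d (x + s *\<^sub>R v)" B h 0]
      der B by simp
  let ?q = "\<lambda>h x. indicator E x *\<^sub>R ((\<psi> (x + h *\<^sub>R v) - \<psi> x) / h)"
  have lim: "((\<lambda>h. \<integral>x. ?q h x \<partial>lborel) \<longlongrightarrow> (LINT x:E|lborel. ?d x)) (at 0)"
    unfolding tendsto_at_iff_sequentially comp_def
  proof (intro allI impI)
    fix X :: "nat \<Rightarrow> real" assume X: "\<forall>i. X i \<in> UNIV - {0}" "X \<longlonglongrightarrow> 0"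
    show "(\<lambda>i. \<integral>x. ?q (X i) x \<partial>lborel) \<longlonglongrightarrow> (LINT x:E|lborel. ?d x)"
      unfolding set_lebesgue_integral_def
    proof (rule integral_dominated_convergence[where w="\<lambda>x. indicator E x *\<^sub>R B"])
      show "integrable lborel (\<lambda>x. indicator E x *\<^sub>R B)"
        using E_finite by simp
      show "AE x in lborel. (\<lambda>i. ?q (X i) x) \<longlonglongrightarrow> indicator E x *\<^sub>R ?d x"
      proof (intro AE_I2 tendsto_scaleR tendsto_const)
        fix x
        have "((\<lambda>h. (\<psi> (x + h *\<^sub>R v) - \<psi> x) / h) \<longlongrightarrow> ?d x) (at 0)"
          using der[of x 0] by (simp add: has_field_derivative_iff)
        then show "(\<lambda>i. (\<psi> (x + X i *\<^sub>R v) - \<psi> x) / X i) \<longlonglongrightarrow> ?d x"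
          using X unfolding tendsto_at_iff_sequentially comp_def by blast
      qed
      show "AE x in lborel. norm (?q (X i) x) \<le> indicator E x *\<^sub>R B" for i
      proof (intro AE_I2)
        fix x
        have "\<bar>\<psi> (x + X i *\<^sub>R v) - \<psi> x\<bar> / \<bar>X i\<bar> \<le> B"
          using lip[of x "X i"] X(1)[rule_format, of i] by (simp add: field_simps)
        then show "norm (?q (X i) x) \<le> indicator E x *\<^sub>R B"
          by (simp add: indicator_def)
      qed
    qed measurable
  qed
  have quot: "(\<integral>x. ?q h x \<partial>lborel)
      = ((LINT x:E|lborel. \<psi> (x + h *\<^sub>R v)) - (LINT x:E|lborel. \<psi> x)) / h" for h
  proof -
    have "set_integrable lborel E (\<lambda>x. \<psi> (x + h *\<^sub>R v))" "set_integrable lborel E \<psi>"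
      using B0 by (intro set_integrable_E[where B=B0]; simp)+
    from set_integral_diff(2)[OF this] show ?thesis
      using integral_divide_zero[of lborel "\<lambda>x. indicator E x * (\<psi> (x + h *\<^sub>R v) - \<psi> x)" h]
      by (simp add: set_lebesgue_integral_def)
  qed
  show ?thesis
    unfolding has_field_derivative_iff using lim unfolding quot by_parts[OF \<psi>, of v] by simp
qed

lemma has_derivative_translated_integral:
  assumes \<psi>: "test_function \<psi>"
  shows "((\<lambda>s. LINT x:E|lborel. \<psi> (x + s *\<^sub>R v)) has_real_derivative
    - (\<integral>x. \<psi> (x + s *\<^sub>R v) * (\<rho> x \<bullet> v) \<partial>M)) (at s)"
  using has_derivative_translated_integral_0[OF test_function_shift[OF \<psi>, of "s *\<^sub>R v"], of v]
    DERIV_shift[of "\<lambda>s. LINT x:E|lborel. \<psi> (x + s *\<^sub>R v)" _ 0 s]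
  by (simp add: algebra_simps)

lemma pairing_le:
  assumes "f \<in> borel_measurable borel" "\<And>x. \<bar>f x\<bar> \<le> 1"
  shows "\<bar>\<integral>x. f x * (\<rho> x \<bullet> v) \<partial>M\<bar> \<le> directional_variation v"
proof -
  note assms(1)[measurable]
  have le: "\<bar>f x * (\<rho> x \<bullet> v)\<bar> \<le> \<bar>\<rho> x \<bullet> v\<bar>" for x
    using assms(2)[of x] by (simp add: abs_mult mult_left_le_one_le)
  have "integrable M (\<lambda>x. f x * (\<rho> x \<bullet> v))"
    by (rule Bochner_Integration.integrable_bound[OF integrable_\<rho>_inner[of v]]) (use le in auto)
  then show ?thesis
    unfolding directional_variation_def
    by (intro order_trans[OF integral_abs_bound] integral_mono integrable_abs integrable_\<rho>_inner le)
qed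

text \<open>Moving the translation from the test function to E turns y into -y. The difference of
  the indicators of E + y and E is 1 and -1 on two disjoint sets, a sign pattern that a test
  function can imitate.\<close>

lemma translated_integral_diff:
  assumes \<psi>: "test_function \<psi>"
  shows "(LINT x:E|lborel. \<psi> (x + y)) - (LINT x:E|lborel. \<psi> x)
    = (\<integral>x. (indicator {x. x + (- y) \<in> E \<and> x \<notin> E} x - indicator {x \<in> E. x + (- y) \<notin> E} x) * \<psi> x \<partial>lborel)"
proof -
  have [measurable]: "\<psi> \<in> borel_measurable borel" using test_function_borel[OF \<psi>] .
  obtain B0 where B0: "\<And>x. \<bar>\<psi> x\<bar> \<le> B0" using test_function_bounded[OF \<psi>] by blast
  have "set_integrable lborel E \<psi>" "set_integrable lborel E (\<lambda>x. \<psi> (x + y))"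
    using B0 by (intro set_integrable_E[where B=B0]; simp)+
  then have int: "integrable lborel (\<lambda>x. indicator E x * \<psi> x)"
    "integrable lborel (\<lambda>x. indicator E x * \<psi> (x + y))"
    by (simp_all add: set_integrable_def)
  let ?f = "\<lambda>x. indicator E (x + (- y)) * \<psi> x"
  have int2: "integrable lborel ?f" and shift: "(LINT x:E|lborel. \<psi> (x + y)) = integral\<^sup>L lborel ?f"
  proof -
    have "integrable (distr lborel borel ((+) y)) ?f"
      using int(2) by (subst integrable_distr_eq) (auto simp: add.commute)
    then show "integrable lborel ?f" by (simp add: lborel_distr_plus)
    have "integral\<^sup>L (distr lborel borel ((+) y)) ?f = (LINT x:E|lborel. \<psi> (x + y))"
      by (subst integral_distr) (auto simp: set_lebesgue_integral_def add.commute)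
    then show "(LINT x:E|lborel. \<psi> (x + y)) = integral\<^sup>L lborel ?f" by (simp add: lborel_distr_plus)
  qed
  have "(LINT x:E|lborel. \<psi> (x + y)) - (LINT x:E|lborel. \<psi> x)
      = (\<integral>x. ?f x - indicator E x * \<psi> x \<partial>lborel)"
    using Bochner_Integration.integral_diff[OF int2 int(1)] shift by (simp add: set_lebesgue_integral_def)
  also have "\<dots> = (\<integral>x. (indicator {x. x + (- y) \<in> E \<and> x \<notin> E} x
      - indicator {x \<in> E. x + (- y) \<notin> E} x) * \<psi> x \<partial>lborel)"
    by (intro Bochner_Integration.integral_cong) (auto simp: indicator_def)
  finally show ?thesis .
qed

lemma translated_integral_diff_le:
  assumes \<psi>: "test_function \<psi>" and le: "\<And>x. \<bar>\<psi> x\<bar> \<le> 1"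
  shows "\<bar>(LINT x:E|lborel. \<psi> (x + y)) - (LINT x:E|lborel. \<psi> x)\<bar> \<le> 2 * exit_volume y"
proof -
  let ?A = "{x. x + (- y) \<in> E \<and> x \<notin> E}" and ?B = "{x \<in> E. x + (- y) \<notin> E}"
  have [measurable]: "\<psi> \<in> borel_measurable borel" using test_function_borel[OF \<psi>] .
  have A: "?A \<in> fmeasurable lborel"
    by (rule fmeasurableI2[OF fmeasurable_shift[of "- y"]]) auto
  note B = fmeasurable_exit[of "- y"]
  have int: "integrable lborel (\<lambda>x. indicator ?A x + indicator ?B x :: real)"
    using A B by (intro Bochner_Integration.integrable_add integrable_real_indicator) (auto simp: fmeasurable_def)
  have bnd: "\<bar>(indicator ?A x - indicator ?B x) * \<psi> x\<bar> \<le> indicator ?A x + indicator ?B x" for x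
    using le[of x] by (auto simp: indicator_def)
  have "\<bar>\<integral>x. (indicator ?A x - indicator ?B x) * \<psi> x \<partial>lborel\<bar>
      \<le> (\<integral>x. indicator ?A x + indicator ?B x \<partial>lborel)"
  proof (intro order_trans[OF integral_abs_bound] integral_mono int bnd integrable_abs)
    show "integrable lborel (\<lambda>x. (indicator ?A x - indicator ?B x) * \<psi> x)"
      by (rule Bochner_Integration.integrable_bound[OF int])
        (use A B bnd in \<open>auto simp: fmeasurable_def\<close>)
  qed
  also have "\<dots> = measure lborel ?A + measure lborel ?B"
    using A B by (subst Bochner_Integration.integral_add) (auto simp: fmeasurable_def)
  also have "\<dots> = 2 * exit_volume y"
    using enter_volume[of "- y"] exit_volume_minus[of y] by (simp add: exit_volume_def)
  finally show ?thesis unfolding translated_integral_diff[OF \<psi>] .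
qed

text \<open>With \<psi> close to that sign pattern, 2 G(y) is nearly the increment over [0, 1] of
  the translated integral in direction y. By \<open>pairing_le\<close> its derivative never exceeds
  V(y), and the mean value inequality concludes.\<close>

lemma exit_volume_le_directional_variation: "2 * exit_volume y \<le> directional_variation y"
proof (rule field_le_epsilon)
  fix \<eta> :: real assume "\<eta> > 0"
  let ?A = "{x. x + (- y) \<in> E \<and> x \<notin> E}" and ?B = "{x \<in> E. x + (- y) \<notin> E}"
  have A: "?A \<in> fmeasurable lborel"
    by (rule fmeasurableI2[OF fmeasurable_shift[of "- y"]]) auto
  note B = fmeasurable_exit[of "- y"]
  have [measurable]: "?A \<in> sets borel" "?B \<in> sets borel" using A B by (auto simp: fmeasurable_def)
  \<comment> \<open>Lebesgue measure is cut down to the symmetric difference, as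
    \<open>test_function_almost_sign\<close> wants a finite measure.\<close>
  define Q where "Q = density lborel (\<lambda>x. ennreal (indicator (?A \<union> ?B) x))"
  have Q: "emeasure Q (?A \<union> ?B) = emeasure lborel (?A \<union> ?B)" "emeasure Q UNIV = emeasure lborel (?A \<union> ?B)"
    unfolding Q_def by (simp_all add: emeasure_density ennreal_indicator flip: indicator_inter_arith)
  have fin: "emeasure lborel (?A \<union> ?B) < \<infinity>" using A B fmeasurable.Un[OF A B] by (simp add: fmeasurable_def)
  have "finite_measure Q" using Q fin by (intro finite_measureI) (simp add: Q_def)
  moreover have "sets Q = sets borel" by (simp add: Q_def)
  ultimately obtain \<psi> where \<psi>: "test_function \<psi>" "\<And>x. \<bar>\<psi> x\<bar> \<le> 1"
    "(\<integral>x. (indicator ?A x - indicator ?B x) * \<psi> x \<partial>Q) \<ge> measure Q (?A \<union> ?B) - \<eta>"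
    using test_function_almost_sign[of Q ?A ?B \<eta>] \<open>\<eta> > 0\<close> by auto
  have [measurable]: "\<psi> \<in> borel_measurable borel" using test_function_borel[OF \<psi>(1)] .
  have "measure Q (?A \<union> ?B) = measure lborel ?A + measure lborel ?B"
  proof -
    have "?A \<inter> ?B = {}" by auto
    then show ?thesis using measure_Un3[OF A B] Q(1) by (simp add: measure_def)
  qed
  also have "\<dots> = 2 * exit_volume y"
    using enter_volume[of "- y"] exit_volume_minus[of y] by (simp add: exit_volume_def)
  finally have "2 * exit_volume y - \<eta> \<le> (\<integral>x. (indicator ?A x - indicator ?B x) * \<psi> x \<partial>Q)"
    using \<psi>(3) by simp
  also have "\<dots> = (\<integral>x. (indicator ?A x - indicator ?B x) * \<psi> x \<partial>lborel)"
    unfolding Q_def by (subst integral_density) (auto intro!: Bochner_Integration.integral_cong simp: indicator_def)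
  also have "\<dots> = (LINT x:E|lborel. \<psi> (x + 1 *\<^sub>R y)) - (LINT x:E|lborel. \<psi> (x + 0 *\<^sub>R y))"
    using translated_integral_diff[OF \<psi>(1), of y] by simp
  also have "\<dots> \<le> \<bar>(LINT x:E|lborel. \<psi> (x + 1 *\<^sub>R y)) - (LINT x:E|lborel. \<psi> (x + 0 *\<^sub>R y))\<bar>" by simp
  also have "\<dots> \<le> directional_variation y"
    using field_differentiable_bound[of UNIV "\<lambda>s. LINT x:E|lborel. \<psi> (x + s *\<^sub>R y)"
        "\<lambda>s. - (\<integral>x. \<psi> (x + s *\<^sub>R y) * (\<rho> x \<bullet> y) \<partial>M)" "directional_variation y" 1 0]
      has_derivative_translated_integral[OF \<psi>(1), of y] pairing_le[of "\<lambda>x. \<psi> (x + _ *\<^sub>R y)" y] \<psi>(2)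
    by simp
  finally show "2 * exit_volume y \<le> directional_variation y + \<eta>" by simp
qed

lemma directional_variation_approx:
  assumes "\<eta> > 0"
  obtains \<psi> where "test_function \<psi>" "\<And>x. \<bar>\<psi> x\<bar> \<le> 1"
    "- (\<integral>x. \<psi> x * (\<rho> x \<bullet> v) \<partial>M) \<ge> directional_variation v - \<eta>"
proof -
  \<comment> \<open>Integration by parts carries a minus sign, so \<psi> should be 1 where
    \<open>\<rho> x \<bullet> v\<close> is negative.\<close>
  let ?A = "{x. \<rho> x \<bullet> v < 0}" and ?B = "{x. \<rho> x \<bullet> v > 0}"
  have space_M: "space M = UNIV" using sets_eq_imp_space_eq[OF sets_M] by simp
  have "{x \<in> space M. \<rho> x \<bullet> v < 0} \<in> sets M" "{x \<in> space M. \<rho> x \<bullet> v > 0} \<in> sets M" by measurable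
  then have [measurable]: "?A \<in> sets borel" "?B \<in> sets borel" by (simp_all add: space_M sets_M)
  define Q where "Q = density M (\<lambda>x. ennreal \<bar>\<rho> x \<bullet> v\<bar>)"
  have Q: "emeasure Q (?A \<union> ?B) = ennreal (directional_variation v)"
    "emeasure Q UNIV = ennreal (directional_variation v)"
  proof -
    have "(\<integral>\<^sup>+x. ennreal \<bar>\<rho> x \<bullet> v\<bar> \<partial>M) = ennreal (directional_variation v)"
      unfolding directional_variation_def
      by (intro nn_integral_eq_integral integrable_abs integrable_\<rho>_inner) auto
    moreover have "ennreal \<bar>\<rho> x \<bullet> v\<bar> * indicator (?A \<union> ?B) x = ennreal \<bar>\<rho> x \<bullet> v\<bar>" for x
      by (auto simp: indicator_def)
    ultimately show "emeasure Q (?A \<union> ?B) = ennreal (directional_variation v)"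
      "emeasure Q UNIV = ennreal (directional_variation v)"
      unfolding Q_def using sets_M by (simp_all add: emeasure_density)
  qed
  have "finite_measure Q" using Q by (intro finite_measureI) (simp add: Q_def space_M)
  moreover have "sets Q = sets borel" by (simp add: Q_def sets_M)
  ultimately obtain \<psi> where \<psi>: "test_function \<psi>" "\<And>x. \<bar>\<psi> x\<bar> \<le> 1"
    "(\<integral>x. (indicator ?A x - indicator ?B x) * \<psi> x \<partial>Q) \<ge> measure Q (?A \<union> ?B) - \<eta>"
    using test_function_almost_sign[of Q ?A ?B \<eta>] \<open>\<eta> > 0\<close> by (auto simp: disjoint_iff)
  have [measurable]: "\<psi> \<in> borel_measurable borel" using test_function_borel[OF \<psi>(1)] .
  have "(\<integral>x. (indicator ?A x - indicator ?B x) * \<psi> x \<partial>Q)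
      = (\<integral>x. \<bar>\<rho> x \<bullet> v\<bar> * ((indicator ?A x - indicator ?B x) * \<psi> x) \<partial>M)"
    unfolding Q_def by (subst integral_density) auto
  also have "\<dots> = (\<integral>x. - (\<psi> x * (\<rho> x \<bullet> v)) \<partial>M)"
    by (intro Bochner_Integration.integral_cong) (auto simp: indicator_def)
  finally have "- (\<integral>x. \<psi> x * (\<rho> x \<bullet> v) \<partial>M) \<ge> directional_variation v - \<eta>"
    using \<psi>(3) Q(1) by (simp add: measure_def directional_variation_nonneg)
  then show thesis using that \<psi> by blast
qed

text \<open>For one fixed, nearly optimal \<psi> the derivative at 0 of the translated integral is
  within \<open>\<eta> / 2\<close> of V(v), and its difference quotients are at most 2 G(t v) / t.
  The \<delta> depends on \<psi>, hence on the direction.\<close>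

lemma exit_volume_lower:
  assumes "\<eta> > 0"
  obtains \<delta> where "\<delta> > 0" "\<And>t. 0 < t \<Longrightarrow> t < \<delta> \<Longrightarrow> (directional_variation v - \<eta>) * t \<le> 2 * exit_volume (t *\<^sub>R v)"
proof -
  obtain \<psi> where \<psi>: "test_function \<psi>" "\<And>x. \<bar>\<psi> x\<bar> \<le> 1"
    "- (\<integral>x. \<psi> x * (\<rho> x \<bullet> v) \<partial>M) \<ge> directional_variation v - \<eta> / 2"
    using directional_variation_approx[of "\<eta> / 2" v] assms by auto
  let ?I = "- (\<integral>x. \<psi> x * (\<rho> x \<bullet> v) \<partial>M)"
  let ?F = "\<lambda>s. LINT x:E|lborel. \<psi> (x + s *\<^sub>R v)"
  have "((\<lambda>h. (?F h - ?F 0) / h) \<longlongrightarrow> ?I) (at 0)"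
    using has_derivative_translated_integral_0[OF \<psi>(1), of v] by (simp add: has_field_derivative_iff)
  then have "\<forall>\<^sub>F h in at 0. ?I - \<eta> / 2 < (?F h - ?F 0) / h"
    by (rule order_tendstoD) (use assms in simp)
  then obtain \<delta> where \<delta>: "\<delta> > 0" "\<And>h. h \<noteq> 0 \<Longrightarrow> \<bar>h\<bar> < \<delta> \<Longrightarrow> ?I - \<eta> / 2 < (?F h - ?F 0) / h"
    by (auto simp: eventually_at dist_real_def)
  show thesis
  proof (rule that[OF \<delta>(1)])
    fix t assume t: "0 < t" "t < \<delta>"
    then have "directional_variation v - \<eta> \<le> (?F t - ?F 0) / t"
      using \<delta>(2)[of t] \<psi>(3) by simp
    then have "(directional_variation v - \<eta>) * t \<le> ?F t - ?F 0"
      using t by (simp add: field_simps)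
    also have "\<dots> \<le> 2 * exit_volume (t *\<^sub>R v)"
      using translated_integral_diff_le[OF \<psi>(1,2), of "t *\<^sub>R v"] by simp
    finally show "(directional_variation v - \<eta>) * t \<le> 2 * exit_volume (t *\<^sub>R v)" .
  qed
qed

text \<open>A finite net of directions suffices: passing from \<theta> to a nearby c changes V by at
  most L |c - \<theta>|, and G(t c) exceeds G(t \<theta>) by at most G(t (c - \<theta>)), which the
  upper bound controls by a multiple of t |c - \<theta>|.\<close>

lemma exit_volume_lower_uniform:
  assumes "\<eta> > 0"
  obtains \<delta> where "\<delta> > 0"
    "\<And>y. norm y < \<delta> \<Longrightarrow> directional_variation y - \<eta> * norm y \<le> 2 * exit_volume y"
proof -
  define L where "L = (\<integral>x. norm (\<rho> x) \<partial>M)"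
  have L: "0 \<le> L" "directional_variation v \<le> L * norm v" for v
    using directional_variation_le by (auto simp: L_def)
  \<comment> \<open>Three errors of \<open>\<eta> / 3\<close>: the change of V, the bound at c, and
    the change of G. The summand 1 keeps the denominator positive when \<open>L = 0\<close>.\<close>
  define r where "r = \<eta> / (3 * (L + 1))"
  have r: "r > 0" "L * r \<le> \<eta> / 3" using assms L(1) by (auto simp: r_def field_simps)
  have "\<exists>\<delta>>0. \<forall>t. 0 < t \<longrightarrow> t < \<delta> \<longrightarrow> (directional_variation v - \<eta> / 3) * t \<le> 2 * exit_volume (t *\<^sub>R v)" for v
    using exit_volume_lower[of "\<eta> / 3" v] assms by (metis divide_pos_pos zero_less_numeral)
  then obtain \<delta>' where \<delta>': "\<And>v. \<delta>' v > 0"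
    "\<And>v t. 0 < t \<Longrightarrow> t < \<delta>' v \<Longrightarrow> (directional_variation v - \<eta> / 3) * t \<le> 2 * exit_volume (t *\<^sub>R v)"
    by metis
  obtain S where S: "finite S" "sphere (0::'a) 1 \<subseteq> (\<Union>c\<in>S. ball c r)"
  proof -
    have "sphere (0::'a) 1 \<subseteq> (\<Union>c\<in>sphere 0 1. ball c r)" using r(1) by auto
    then obtain S where "finite S" "sphere (0::'a) 1 \<subseteq> (\<Union>c\<in>S. ball c r)"
      by (rule compactE_image[OF compact_sphere[of "0::'a" 1] open_ball])
    then show thesis by (rule that)
  qed
  define \<delta> where "\<delta> = Min (insert 1 (\<delta>' ` S))"
  have \<delta>: "\<delta> > 0" "\<And>c. c \<in> S \<Longrightarrow> \<delta> \<le> \<delta>' c" using S(1) \<delta>'(1) by (auto simp: \<delta>_def)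
  show thesis
  proof (rule that[OF \<delta>(1)])
    fix y :: 'a assume y: "norm y < \<delta>"
    show "directional_variation y - \<eta> * norm y \<le> 2 * exit_volume y"
    proof (cases "y = 0")
      case True
      then show ?thesis using L(2)[of 0] exit_volume_nonneg[of 0] by simp
    next
      case False
      define t where "t = norm y"
      define \<theta> where "\<theta> = y /\<^sub>R t"
      have t: "0 < t" "t < \<delta>" and y_eq: "y = t *\<^sub>R \<theta>" and "\<theta> \<in> sphere 0 1"
        using False y by (auto simp: t_def \<theta>_def)
      then obtain c where c: "c \<in> S" "dist c \<theta> < r" using S(2) by auto
      have cr: "directional_variation (c - \<theta>) \<le> \<eta> / 3" "directional_variation (\<theta> - c) \<le> \<eta> / 3"
      proof -
        have "L * norm (c - \<theta>) \<le> L * r" "L * norm (\<theta> - c) \<le> L * r"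
          using c(2) L(1) by (auto intro!: mult_left_mono simp: dist_norm norm_minus_commute)
        then show "directional_variation (c - \<theta>) \<le> \<eta> / 3" "directional_variation (\<theta> - c) \<le> \<eta> / 3"
          using L(2)[of "c - \<theta>"] L(2)[of "\<theta> - c"] r(2) by linarith+
      qed
      have "directional_variation \<theta> \<le> directional_variation c + \<eta> / 3"
        using directional_variation_le_add[of c "\<theta> - c"] cr by simp
      then have "(directional_variation \<theta> - \<eta>) * t \<le> (directional_variation c - \<eta> / 3) * t - \<eta> / 3 * t"
        using t(1) by (subst left_diff_distrib[symmetric], intro mult_right_mono) auto
      also have "(directional_variation c - \<eta> / 3) * t \<le> 2 * exit_volume (t *\<^sub>R c)"
        using \<delta>'(2)[of t c] t \<delta>(2)[OF c(1)] by simp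
      also have "2 * exit_volume (t *\<^sub>R c) \<le> 2 * exit_volume y + 2 * exit_volume (t *\<^sub>R (c - \<theta>))"
        using exit_volume_add[of y "t *\<^sub>R (c - \<theta>)"] by (simp add: y_eq algebra_simps)
      also have "2 * exit_volume (t *\<^sub>R (c - \<theta>)) \<le> \<eta> / 3 * t"
      proof -
        have "t * directional_variation (c - \<theta>) \<le> t * (\<eta> / 3)"
          using cr(1) t(1) by (intro mult_left_mono) auto
        moreover have "2 * exit_volume (t *\<^sub>R (c - \<theta>)) \<le> t * directional_variation (c - \<theta>)"
          using exit_volume_le_directional_variation[of "t *\<^sub>R (c - \<theta>)"] t(1)
          unfolding directional_variation_scale by simp
        ultimately show ?thesis by (simp only: mult.commute[of _ t])
      qed
      finally show ?thesis
        using t(1) unfolding y_eq directional_variation_scale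
        by (simp add: algebra_simps \<open>\<theta> \<in> sphere 0 1\<close>[unfolded mem_sphere_0])
    qed
  qed
qed

section \<open>Regularity of G and V, and the rescaled perimeter as an integral\<close>

lemma exit_volume_continuous: "continuous_on UNIV exit_volume"
proof -
  define L where "L = (\<integral>x. norm (\<rho> x) \<partial>M)"
  have "exit_volume y - exit_volume z \<le> L * norm (y - z)" for y z
  proof -
    have "exit_volume y \<le> exit_volume z + exit_volume (y - z)"
      using exit_volume_add[of z "y - z"] by simp
    then show ?thesis
      using exit_volume_le_directional_variation[of "y - z"] directional_variation_le[of "y - z"]
        exit_volume_nonneg[of "y - z"] unfolding L_def by linarith
  qed
  then have "\<bar>exit_volume y - exit_volume z\<bar> \<le> L * norm (y - z)" for y z
    by (simp add: abs_le_iff) (metis norm_minus_commute)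
  then have "L-lipschitz_on UNIV exit_volume"
    by (intro lipschitz_onI) (auto simp: dist_norm L_def)
  then show ?thesis by (rule lipschitz_on_continuous_on)
qed

lemma directional_variation_continuous: "continuous_on UNIV directional_variation"
proof -
  define L where "L = (\<integral>x. norm (\<rho> x) \<partial>M)"
  have "directional_variation y - directional_variation z \<le> L * norm (y - z)" for y z
    using directional_variation_le_add[of z "y - z"] directional_variation_le[of "y - z"]
    unfolding L_def by simp
  then have "\<bar>directional_variation y - directional_variation z\<bar> \<le> L * norm (y - z)" for y z
    by (simp add: abs_le_iff) (metis norm_minus_commute)
  then have "L-lipschitz_on UNIV directional_variation"
    by (intro lipschitz_onI) (auto simp: dist_norm L_def)
  then show ?thesis by (rule lipschitz_on_continuous_on)
qed

lemma exit_volume_borel [measurable]: "exit_volume \<in> borel_measurable borel"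
  by (rule borel_measurable_continuous_onI[OF exit_volume_continuous])

lemma directional_variation_borel [measurable]: "directional_variation \<in> borel_measurable borel"
  by (rule borel_measurable_continuous_onI[OF directional_variation_continuous])

text \<open>Tonelli needs \<sigma>-finiteness, which is available for the finite measure
  \<open>lam\<close>: its density is inverted and \<nu> written as a density with respect to
  \<open>lam\<close>. The inversion fails at the origin alone, a null set of \<nu>.\<close>

lemma nonlocal_perimeter_eq:
  fixes C R :: ennreal
  assumes \<nu>: "sets \<nu> = sets borel" "emeasure \<nu> {0} = 0"
    and C: "0 < C" "C < \<infinity>" and R: "1 \<le> R"
    and lam: "lam = density \<nu> (\<lambda>x. inverse C * min R (ennreal (norm x)))" "finite_measure lam"
  shows "inverse C * nonlocal_perimeter \<nu> E
    = (\<integral>\<^sup>+y. ennreal (exit_volume y) * inverse (min R (ennreal (norm y))) \<partial>lam)"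
proof -
  note \<nu>(1)[measurable_cong]
  interpret lam: finite_measure lam by fact
  interpret P: pair_sigma_finite lborel lam ..
  have sets_lam: "sets lam = sets borel" using lam(1) \<nu>(1) by simp
  note sets_lam[measurable_cong]
  let ?k = "\<lambda>y. C * inverse (min R (ennreal (norm y)))"
  have "inverse C * min R (ennreal (norm y)) * ?k y = 1" if "y \<noteq> 0" for y :: 'a
  proof -
    let ?m = "min R (ennreal (norm y))"
    have "?m \<noteq> 0" using R that by (auto simp: min_def)
    \<comment> \<open>\<open>R\<close> may be infinite, but its minimum with the norm is
      not.\<close>
    moreover have "?m \<noteq> top"
      using min.cobounded2[of R "ennreal (norm y)"] by (metis ennreal_neq_top top_unique)
    ultimately have "?m * inverse ?m = 1" using ennreal_divide_self[of ?m] by (simp add: divide_ennreal_def less_top)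
    moreover have "inverse C * C = 1" using C ennreal_divide_self[of C] by (simp add: divide_ennreal_def mult.commute)
    ultimately show ?thesis by (metis mult.assoc mult.commute mult_1)
  qed
  moreover have "AE y in \<nu>. y \<noteq> 0"
    using \<nu> by (intro AE_I[of _ _ "{0}"]) auto
  ultimately have "AE y in \<nu>. 1 = inverse C * min R (ennreal (norm y)) * ?k y" by auto
  then have "density \<nu> (\<lambda>_. 1) = density \<nu> (\<lambda>y. inverse C * min R (ennreal (norm y)) * ?k y)"
    by (intro density_cong) measurable
  then have \<nu>_eq: "\<nu> = density lam ?k"
    unfolding lam(1) by (subst density_density_eq) (auto simp: density_1)
  have inner: "emeasure \<nu> ((\<lambda>z. z - x) ` (- E)) = (\<integral>\<^sup>+y. ?k y * indicator (- E) (x + y) \<partial>lam)" for x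
  proof -
    have eq: "(\<lambda>z. z - x) ` (- E) = {y. x + y \<in> - E}"
    proof (intro set_eqI iffI)
      fix y assume "y \<in> {y. x + y \<in> - E}"
      then show "y \<in> (\<lambda>z. z - x) ` (- E)" by (intro image_eqI[of _ _ "x + y"]) auto
    qed auto
    have "{y \<in> space borel. x + y \<in> - E} \<in> sets borel" by measurable
    then have "{y. x + y \<in> - E} \<in> sets lam" by (simp add: sets_lam)
    then show ?thesis
      unfolding eq \<nu>_eq by (subst emeasure_density) (auto intro!: nn_integral_cong simp: indicator_def)
  qed
  let ?g = "\<lambda>x y. ?k y * indicator (- E) (x + y) * indicator E x"
  have "inverse C * nonlocal_perimeter \<nu> E = inverse C * (\<integral>\<^sup>+x. (\<integral>\<^sup>+y. ?g x y \<partial>lam) \<partial>lborel)"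
    unfolding nonlocal_perimeter_def inner by (simp add: nn_integral_multc)
  also have "(\<integral>\<^sup>+x. (\<integral>\<^sup>+y. ?g x y \<partial>lam) \<partial>lborel) = (\<integral>\<^sup>+y. (\<integral>\<^sup>+x. ?g x y \<partial>lborel) \<partial>lam)"
    by (rule P.Fubini'[symmetric]) measurable
  also have "\<dots> = (\<integral>\<^sup>+y. ?k y * ennreal (exit_volume y) \<partial>lam)"
  proof (rule nn_integral_cong)
    fix y
    have "(\<integral>\<^sup>+x. ?g x y \<partial>lborel) = (\<integral>\<^sup>+x. ?k y * indicator {x \<in> E. x + y \<notin> E} x \<partial>lborel)"
      by (intro nn_integral_cong) (auto simp: indicator_def)
    also have "\<dots> = ?k y * ennreal (exit_volume y)"
    proof -
      have "{x \<in> E. x + y \<notin> E} \<in> sets lborel" "emeasure lborel {x \<in> E. x + y \<notin> E} \<noteq> \<infinity>"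
        using fmeasurable_exit[of y] by (auto simp: fmeasurable_def)
      then show ?thesis
        unfolding exit_volume_def
        by (subst nn_integral_cmult_indicator) (simp_all add: emeasure_eq_ennreal_measure)
    qed
    finally show "(\<integral>\<^sup>+x. ?g x y \<partial>lborel) = ?k y * ennreal (exit_volume y)" .
  qed
  also have "\<dots> = C * (\<integral>\<^sup>+y. ennreal (exit_volume y) * inverse (min R (ennreal (norm y))) \<partial>lam)"
    by (subst nn_integral_cmult[symmetric]) (auto simp: mult_ac)
  finally show ?thesis
    using C ennreal_divide_self[of C] by (simp add: divide_ennreal_def mult.assoc[symmetric] mult.commute)
qed

lemma angular_variation_integral:
  fixes lam :: "'a measure"
  assumes "sets lam = sets borel" "finite_measure lam"
  shows "(\<integral>\<theta>. directional_variation \<theta> \<partial>angular_measure lam)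
    = (\<integral>y. directional_variation (y /\<^sub>R norm y) \<partial>lam)"
proof -
  note assms(1)[measurable_cong]
  have meas: "directional_variation \<in> borel_measurable sphere_borel"
    by (rule measurable_restrict_space1) measurable
  then have meas': "directional_variation \<in> borel_measurable (angular_measure lam)"
    by (simp add: angular_measure_def)
  have dv0: "directional_variation 0 = 0" by (simp add: directional_variation_def)
  have "(\<integral>\<^sup>+\<theta>. ennreal (directional_variation \<theta>) \<partial>angular_measure lam)
      = (\<integral>\<^sup>+y. ennreal (directional_variation (y /\<^sub>R norm y)) * indicator {0<..} (norm y) \<partial>lam)"
    unfolding angular_measure_def using meas assms(1)
    by (intro nn_integral_polar_measure) auto
  also have "\<dots> = (\<integral>\<^sup>+y. ennreal (directional_variation (y /\<^sub>R norm y)) \<partial>lam)"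
    by (intro nn_integral_cong) (auto simp: indicator_def dv0)
  finally show ?thesis
    using meas' by (subst (1 2) integral_eq_nn_integral) (auto simp: directional_variation_nonneg)
qed

text \<open>A real version of G(y) / (R \<and> |y|), so that absolute values of differences are
  available. An infinite \<open>R\<close> is allowed; at the origin \<open>enn2real top = 0\<close>
  gives the value 0.\<close>

definition rescaled_exit_volume :: "ennreal \<Rightarrow> 'a \<Rightarrow> real" where
  "rescaled_exit_volume R y = exit_volume y * enn2real (inverse (min R (ennreal (norm y))))"

text \<open>The truncation acts only where |y| > R \<ge> 1, and there it divides by a number that is
  at least 1.\<close>

lemma rescaled_exit_volume_cases:
  assumes "1 \<le> R" "y \<noteq> 0"
  shows "rescaled_exit_volume R y = exit_volume y / norm y
    \<or> 1 < norm y \<and> rescaled_exit_volume R y \<le> exit_volume y"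
proof (cases "ennreal (norm y) \<le> R")
  case True
  then have "min R (ennreal (norm y)) = ennreal (norm y)" by (simp add: min_def)
  then show ?thesis
    using assms by (simp add: rescaled_exit_volume_def inverse_ennreal divide_inverse)
next
  case False
  then have "1 < ennreal (norm y)" using assms by (metis not_le order_le_less_trans)
  then have "1 < norm y" by (simp add: ennreal_less_iff flip: ennreal_1)
  have "min R (ennreal (norm y)) = R" using False by (simp add: min_def)
  moreover have "inverse R \<le> 1"
    using assms(1) by (cases R) (auto simp: inverse_ennreal ennreal_le_1 field_simps)
  then have "enn2real (inverse R) \<le> 1" by (metis enn2real_1 enn2real_mono ennreal_one_less_top)
  ultimately show ?thesis
    using \<open>1 < norm y\<close> exit_volume_nonneg[of y]
    by (simp add: rescaled_exit_volume_def mult_left_le)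
qed

text \<open>Without truncation the linear bound on G applies, with truncation the bound of G by the
  volume of E; the sum of the two constants covers both cases, uniformly in
  \<open>R\<close>.\<close>

lemma rescaled_exit_volume_bounds:
  assumes "1 \<le> R"
  shows "0 \<le> rescaled_exit_volume R y"
    "rescaled_exit_volume R y \<le> measure lborel E + (\<integral>x. norm (\<rho> x) \<partial>M)"
proof -
  show "0 \<le> rescaled_exit_volume R y"
    by (simp add: rescaled_exit_volume_def exit_volume_nonneg)
  have L: "0 \<le> (\<integral>x. norm (\<rho> x) \<partial>M)" by simp
  show "rescaled_exit_volume R y \<le> measure lborel E + (\<integral>x. norm (\<rho> x) \<partial>M)"
  proof (cases "y = 0")
    case True
    then show ?thesis using assms L by (simp add: rescaled_exit_volume_def min_def)
  next
    case False
    have "exit_volume y \<le> (\<integral>x. norm (\<rho> x) \<partial>M) * norm y"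
      using exit_volume_le_directional_variation[of y] directional_variation_le[of y] exit_volume_nonneg[of y]
      by linarith
    then have "exit_volume y / norm y \<le> (\<integral>x. norm (\<rho> x) \<partial>M)" using False by (simp add: field_simps)
    then show ?thesis
      using rescaled_exit_volume_cases[OF assms False] exit_volume_le[of y] L
        measure_nonneg[of lborel E] by linarith
  qed
qed

lemma rescaled_exit_volume_borel [measurable]: "rescaled_exit_volume R \<in> borel_measurable borel"
  unfolding rescaled_exit_volume_def[abs_def] by measurable

lemma nonlocal_perimeter_eq_integral:
  fixes C R :: ennreal
  assumes \<nu>: "sets \<nu> = sets borel" "emeasure \<nu> {0} = 0"
    and C: "0 < C" "C < \<infinity>" and R: "1 \<le> R"
    and lam: "lam = density \<nu> (\<lambda>x. inverse C * min R (ennreal (norm x)))" "finite_measure lam"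
  shows "inverse C * nonlocal_perimeter \<nu> E = ennreal (\<integral>y. rescaled_exit_volume R y \<partial>lam)"
proof -
  interpret lam: finite_measure lam by fact
  have sets_lam: "sets lam = sets borel" using lam(1) \<nu>(1) by simp
  note sets_lam[measurable_cong] \<nu>(1)[measurable_cong]
  have "AE y in \<nu>. y \<noteq> 0"
    using \<nu> by (intro AE_I[of _ _ "{0}"]) auto
  then have "AE y in lam. y \<noteq> 0"
    unfolding lam(1) by (subst AE_density) auto
  then have "(\<integral>\<^sup>+y. ennreal (exit_volume y) * inverse (min R (ennreal (norm y))) \<partial>lam)
      = (\<integral>\<^sup>+y. ennreal (rescaled_exit_volume R y) \<partial>lam)"
  proof (intro nn_integral_cong_AE, eventually_elim)
    fix y :: 'a assume "y \<noteq> 0"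
    then have "min R (ennreal (norm y)) \<noteq> 0" using R by (auto simp: min_def)
    then have "inverse (min R (ennreal (norm y))) < top" by (simp add: less_top[symmetric])
    then show "ennreal (exit_volume y) * inverse (min R (ennreal (norm y))) = ennreal (rescaled_exit_volume R y)"
      by (simp add: rescaled_exit_volume_def ennreal_mult exit_volume_nonneg)
  qed
  also have "\<dots> = ennreal (\<integral>y. rescaled_exit_volume R y \<partial>lam)"
  proof (rule nn_integral_eq_integral)
    show "integrable lam (rescaled_exit_volume R)"
      using rescaled_exit_volume_bounds[OF R]
      by (intro lam.integrable_const_bound[where B="measure lborel E + (\<integral>x. norm (\<rho> x) \<partial>M)"]) auto
  qed (use rescaled_exit_volume_bounds(1)[OF R] in auto)
  finally show ?thesis using nonlocal_perimeter_eq[OF assms] by simp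
qed

lemma rescaled_exit_volume_approx:
  assumes "\<eta> > 0"
  obtains r where "r > 0" "\<And>R y. 1 \<le> R \<Longrightarrow>
    \<bar>rescaled_exit_volume R y - directional_variation (y /\<^sub>R norm y) / 2\<bar>
      \<le> \<eta> + (measure lborel E + (\<integral>x. norm (\<rho> x) \<partial>M)) * indicator (- cball 0 r) y"
proof -
  obtain \<delta> where \<delta>: "\<delta> > 0"
    "\<And>y. norm y < \<delta> \<Longrightarrow> directional_variation y - \<eta> * norm y \<le> 2 * exit_volume y"
    using exit_volume_lower_uniform[OF assms] by blast
  \<comment> \<open>\<open>r \<le> 1\<close> keeps the truncation inactive on the ball, whatever
    \<open>R\<close> is; halving \<delta> fits a closed ball under a strict bound.\<close>
  define r where "r = min 1 (\<delta> / 2)"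
  have r: "0 < r" "r \<le> 1" "r < \<delta>" using \<delta>(1) by (auto simp: r_def)
  show thesis
  proof (rule that[OF r(1)])
    fix R :: ennreal and y :: 'a assume R: "1 \<le> R"
    let ?L = "\<integral>x. norm (\<rho> x) \<partial>M"
    show "\<bar>rescaled_exit_volume R y - directional_variation (y /\<^sub>R norm y) / 2\<bar>
        \<le> \<eta> + (measure lborel E + ?L) * indicator (- cball 0 r) y"
    proof (cases "y \<in> cball 0 r")
      case False
      have "norm (y /\<^sub>R norm y) \<le> 1" by (cases "y = 0") auto
      then have "?L * norm (y /\<^sub>R norm y) \<le> ?L" by (intro mult_left_le) auto
      then have "directional_variation (y /\<^sub>R norm y) \<le> ?L"
        using directional_variation_le[of "y /\<^sub>R norm y"] by linarith
      moreover have "0 \<le> ?L" by simp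
      moreover have "indicator (- cball 0 r) y = (1 :: real)" using False by simp
      ultimately show ?thesis
        using assms rescaled_exit_volume_bounds[OF R, of y] directional_variation_nonneg[of "y /\<^sub>R norm y"]
          measure_nonneg[of lborel E]
        unfolding abs_le_iff by (simp only: mult_1_right) linarith
    next
      case True
      then have y: "norm y \<le> 1" "norm y < \<delta>" using r by auto
      show ?thesis
      proof (cases "y = 0")
        case True
        then show ?thesis using assms R r by (simp add: rescaled_exit_volume_def directional_variation_def min_def)
      next
        case False
        have "rescaled_exit_volume R y = exit_volume y / norm y"
          using rescaled_exit_volume_cases[OF R False] y(1) by auto
        moreover have "directional_variation (y /\<^sub>R norm y) = directional_variation y / norm y"
          by (simp add: directional_variation_scale field_simps)
        ultimately have "rescaled_exit_volume R y - directional_variation (y /\<^sub>R norm y) / 2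
            = (2 * exit_volume y - directional_variation y) / (2 * norm y)"
          using False by (simp add: field_simps)
        moreover have "\<bar>2 * exit_volume y - directional_variation y\<bar> \<le> \<eta> * norm y"
          using \<delta>(2)[OF y(2)] exit_volume_le_directional_variation[of y] assms
          by (simp add: abs_le_iff)
        then have "\<bar>2 * exit_volume y - directional_variation y\<bar> / (2 * norm y) \<le> \<eta> / 2"
          using False by (simp add: field_simps)
        ultimately show ?thesis using True assms by (simp add: abs_divide)
      qed
    qed
  qed
qed

text \<open>The integrand varies with j through \<open>R j\<close>. It is exchanged for V(y / |y|) /
  2, which does not, and whose integral is half the integral of V against the angular measure. The
  exchange costs an arbitrarily small constant plus a fixed multiple of the mass outside a
  ball.\<close>

lemma rescaled_exit_volume_limit:
  fixes lam :: "nat \<Rightarrow> 'a measure" and R :: "nat \<Rightarrow> ennreal"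
  assumes lam: "\<And>j. prob_space (lam j)" "\<And>j. sets (lam j) = sets borel"
    and R: "\<And>j. 1 \<le> R j"
    and conc: "\<And>r. r > 0 \<Longrightarrow> (\<lambda>j. emeasure (lam j) (- cball 0 r)) \<longlonglongrightarrow> 0"
    and conv: "sphere_weak_conv (\<lambda>j. angular_measure (lam j)) \<mu>"
  shows "(\<lambda>j. \<integral>y. rescaled_exit_volume (R j) y \<partial>lam j)
    \<longlonglongrightarrow> (\<integral>\<theta>. directional_variation \<theta> \<partial>\<mu>) / 2"
proof -
  let ?L = "\<integral>x. norm (\<rho> x) \<partial>M"
  let ?u = "\<lambda>y. directional_variation (y /\<^sub>R norm y) / 2"
  have fin: "finite_measure (lam j)" for j using lam(1) by (simp add: prob_space.finite_measure)
  have "(\<lambda>j. \<integral>\<theta>. directional_variation \<theta> \<partial>angular_measure (lam j)) \<longlonglongrightarrow> (\<integral>\<theta>. directional_variation \<theta> \<partial>\<mu>)"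
    using conv continuous_on_subset[OF directional_variation_continuous]
    unfolding sphere_weak_conv_def by auto
  then have lim: "(\<lambda>j. \<integral>y. ?u y \<partial>lam j) \<longlonglongrightarrow> (\<integral>\<theta>. directional_variation \<theta> \<partial>\<mu>) / 2"
    unfolding angular_variation_integral[OF lam(2) fin] by (auto intro: tendsto_divide)
  have "(\<lambda>j. (\<integral>y. rescaled_exit_volume (R j) y \<partial>lam j) - (\<integral>y. ?u y \<partial>lam j)) \<longlonglongrightarrow> 0"
  proof (rule LIMSEQ_I)
    fix \<eta> :: real assume "\<eta> > 0"
    let ?B = "measure lborel E + ?L"
    have B: "0 \<le> ?B" by simp
    obtain r where r: "r > 0" "\<And>R y. 1 \<le> R \<Longrightarrow> \<bar>rescaled_exit_volume R y - ?u y\<bar>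
      \<le> \<eta> / 2 + ?B * indicator (- cball 0 r) y"
      using rescaled_exit_volume_approx[of "\<eta> / 2"] \<open>\<eta> > 0\<close> by auto
    have "(\<lambda>j. measure (lam j) (- cball 0 r)) \<longlonglongrightarrow> 0"
      using tendsto_enn2real[OF conc[OF r(1), folded ennreal_0]] by (simp add: measure_def)
    then have "(\<lambda>j. ?B * measure (lam j) (- cball 0 r)) \<longlonglongrightarrow> 0"
      by (rule tendsto_mult_right_zero)
    then have "\<forall>\<^sub>F j in sequentially. ?B * measure (lam j) (- cball 0 r) < \<eta> / 2"
      using \<open>\<eta> > 0\<close> by (intro order_tendstoD) auto
    moreover have "\<bar>(\<integral>y. rescaled_exit_volume (R j) y \<partial>lam j) - (\<integral>y. ?u y \<partial>lam j)\<bar>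
        \<le> \<eta> / 2 + ?B * measure (lam j) (- cball 0 r)" for j
    proof -
      interpret prob_space "lam j" by (rule lam)
      note lam(2)[measurable_cong]
      have cb: "- cball 0 r \<in> sets (lam j)" by (simp add: lam(2))
      have int1: "integrable (lam j) (rescaled_exit_volume (R j))"
        using rescaled_exit_volume_bounds[OF R]
        by (intro integrable_const_bound[where B="?B"]) auto
      have "?u y \<le> ?L" for y
      proof -
        have "norm (y /\<^sub>R norm y) \<le> 1" by (cases "y = 0") auto
        then have "?L * norm (y /\<^sub>R norm y) \<le> ?L" by (intro mult_left_le) auto
        then show ?thesis
          using directional_variation_le[of "y /\<^sub>R norm y"] directional_variation_nonneg[of "y /\<^sub>R norm y"] by linarith
      qed
      then have int2: "integrable (lam j) ?u"
        using directional_variation_nonneg by (intro integrable_const_bound[where B="?L"]) auto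
      have "\<bar>(\<integral>y. rescaled_exit_volume (R j) y \<partial>lam j) - (\<integral>y. ?u y \<partial>lam j)\<bar>
          = \<bar>\<integral>y. rescaled_exit_volume (R j) y - ?u y \<partial>lam j\<bar>"
        using int1 int2 by (subst Bochner_Integration.integral_diff) auto
      also have "\<dots> \<le> (\<integral>y. \<bar>rescaled_exit_volume (R j) y - ?u y\<bar> \<partial>lam j)"
        by (rule integral_abs_bound)
      also have "\<dots> \<le> (\<integral>y. \<eta> / 2 + ?B * indicator (- cball 0 r) y \<partial>lam j)"
        using int1 int2 cb
        by (intro integral_mono integrable_abs Bochner_Integration.integrable_diff
            Bochner_Integration.integrable_add integrable_mult_right r(2)[OF R])
          (auto simp: emeasure_eq_measure)
      also have "\<dots> = \<eta> / 2 + ?B * measure (lam j) (- cball 0 r)"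
        using cb by (subst Bochner_Integration.integral_add) (auto simp: emeasure_eq_measure prob_space)
      finally show ?thesis .
    qed
    ultimately have "\<forall>\<^sub>F j in sequentially. \<bar>(\<integral>y. rescaled_exit_volume (R j) y \<partial>lam j) - (\<integral>y. ?u y \<partial>lam j)\<bar> < \<eta>"
      by (elim eventually_mono) (smt (verit) field_sum_of_halves)
    then show "\<exists>no. \<forall>n\<ge>no. norm ((\<integral>y. rescaled_exit_volume (R n) y \<partial>lam n) - (\<integral>y. ?u y \<partial>lam n) - 0) < \<eta>"
      by (simp add: eventually_sequentially)
  qed
  from tendsto_add[OF this lim] show ?thesis by simp
qed

text \<open>Exchanging the integrals over \<theta> and x leaves the surface integral of
  |\<open>\<rho>\<close> . \<theta>|, which is |\<open>\<rho>\<close>| times K_{1,d} by homogeneity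
  and independence of the direction.\<close>

lemma surface_directional_variation:
  assumes fin: "emeasure surface_measure (sphere 0 1 :: 'a set) < \<infinity>" and e: "norm (e::'a) = 1"
  shows "(\<integral>\<^sup>+\<theta>. ennreal (directional_variation \<theta>) \<partial>surface_measure)
    = (\<integral>\<^sup>+\<theta>. ennreal \<bar>e \<bullet> \<theta>\<bar> \<partial>surface_measure) * (\<integral>\<^sup>+x. ennreal (norm (\<rho> x)) \<partial>M)"
proof -
  let ?S = "surface_measure :: 'a measure"
  have sets_S [measurable_cong]: "sets ?S = sets sphere_borel" by (simp add: surface_measure_def)
  have space_S: "space ?S = sphere 0 1"
    using sets_eq_imp_space_eq[OF sets_S] by (simp add: space_restrict_space)
  interpret S: finite_measure ?S using fin by (intro finite_measureI) (simp add: space_S)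
  interpret M: finite_measure M by (rule M_finite)
  interpret P: pair_sigma_finite ?S M ..
  have id_meas [measurable]: "(\<lambda>\<theta>. \<theta>) \<in> ?S \<rightarrow>\<^sub>M borel"
    by (simp add: measurable_cong_sets[OF sets_S refl] measurable_restrict_space1)
  let ?K = "\<integral>\<^sup>+\<theta>. ennreal \<bar>e \<bullet> \<theta>\<bar> \<partial>?S"
  have inner: "(\<integral>\<^sup>+\<theta>. ennreal \<bar>v \<bullet> \<theta>\<bar> \<partial>?S) = ennreal (norm v) * ?K" for v :: 'a
  proof (cases "v = 0")
    case False
    have "(\<integral>\<^sup>+\<theta>. ennreal \<bar>v \<bullet> \<theta>\<bar> \<partial>?S) = (\<integral>\<^sup>+\<theta>. ennreal (norm v) * ennreal \<bar>(v /\<^sub>R norm v) \<bullet> \<theta>\<bar> \<partial>?S)"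
      using False by (intro nn_integral_cong) (simp add: abs_mult flip: ennreal_mult)
    also have "\<dots> = ennreal (norm v) * (\<integral>\<^sup>+\<theta>. ennreal \<bar>(v /\<^sub>R norm v) \<bullet> \<theta>\<bar> \<partial>?S)"
      by (rule nn_integral_cmult) measurable
    also have "(\<integral>\<^sup>+\<theta>. ennreal \<bar>(v /\<^sub>R norm v) \<bullet> \<theta>\<bar> \<partial>?S) = ?K"
      using False e by (intro surface_abs_inner_eq) auto
    finally show ?thesis .
  qed simp
  have "(\<integral>\<^sup>+\<theta>. ennreal (directional_variation \<theta>) \<partial>?S) = (\<integral>\<^sup>+\<theta>. (\<integral>\<^sup>+x. ennreal \<bar>\<rho> x \<bullet> \<theta>\<bar> \<partial>M) \<partial>?S)"
  proof (rule nn_integral_cong)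
    fix \<theta>
    show "ennreal (directional_variation \<theta>) = (\<integral>\<^sup>+x. ennreal \<bar>\<rho> x \<bullet> \<theta>\<bar> \<partial>M)"
      unfolding directional_variation_def
      by (intro nn_integral_eq_integral[symmetric] integrable_abs integrable_\<rho>_inner) auto
  qed
  also have "\<dots> = (\<integral>\<^sup>+x. (\<integral>\<^sup>+\<theta>. ennreal \<bar>\<rho> x \<bullet> \<theta>\<bar> \<partial>?S) \<partial>M)"
  proof (rule P.Fubini'[symmetric])
    have "(\<lambda>p. \<rho> (snd p)) \<in> borel_measurable (?S \<Otimes>\<^sub>M M)" "(\<lambda>p. fst p) \<in> borel_measurable (?S \<Otimes>\<^sub>M M)"
      using measurable_compose[OF measurable_snd \<rho>_borel] measurable_compose[OF measurable_fst id_meas]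
      by auto
    then have "(\<lambda>p. ennreal \<bar>\<rho> (snd p) \<bullet> fst p\<bar>) \<in> borel_measurable (?S \<Otimes>\<^sub>M M)"
      by (intro measurable_compose[OF _ measurable_ennreal] borel_measurable_abs borel_measurable_inner)
    then show "(\<lambda>(\<theta>, x). ennreal \<bar>\<rho> x \<bullet> \<theta>\<bar>) \<in> borel_measurable (?S \<Otimes>\<^sub>M M)"
      by (simp only: case_prod_beta')
  qed
  also have "\<dots> = (\<integral>\<^sup>+x. ennreal (norm (\<rho> x)) * ?K \<partial>M)" by (intro nn_integral_cong inner)
  also have "\<dots> = (\<integral>\<^sup>+x. ennreal (norm (\<rho> x)) \<partial>M) * ?K" by (rule nn_integral_multc) measurable
  finally show ?thesis by (simp add: mult.commute)
qed

end

subsection \<open>The limit of the rescaled perimeters\<close>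

text \<open>Finite perimeter rules out the default value \<infinity>, so a gradient exists and the
  choice in \<open>indicator_gradient\<close> is a genuine one. One pair \<open>M\<close>,
  \<open>\<rho>\<close> then computes the perimeter and all directional variations.\<close>

lemma finite_perimeter_exists:
  fixes E :: "'a::euclidean_space set"
  assumes E: "E \<in> sets borel" "emeasure lborel E < \<infinity>" "perimeter E < \<infinity>"
  obtains M \<rho> where "finite_perimeter E M \<rho>" "perimeter E = (\<integral>\<^sup>+x. ennreal (norm (\<rho> x)) \<partial>M)"
    "\<And>\<theta>. total_variation (\<lambda>A. indicator_gradient E A \<bullet> \<theta>) UNIV
      = ennreal (finite_perimeter.directional_variation M \<rho> \<theta>)"
proof -
  have ex: "\<exists>m. is_indicator_gradient E m" using E(3) by (auto simp: perimeter_def split: if_splits)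
  then have "is_indicator_gradient E (indicator_gradient E)"
    unfolding indicator_gradient_def by (rule someI_ex)
  then obtain M :: "'a measure" and \<rho> :: "'a \<Rightarrow> 'a" where M: "finite_measure M" "sets M = sets borel"
    and \<rho>: "integrable M \<rho>" "\<And>A. A \<in> sets borel \<Longrightarrow> indicator_gradient E A = (LINT x:A|M. \<rho> x)"
    and parts: "\<And>\<phi> v. test_function \<phi> \<Longrightarrow>
      (LINT x:E|lborel. frechet_derivative \<phi> (at x) v) = - (\<integral>x. \<phi> x * (\<rho> x \<bullet> v) \<partial>M)"
    using indicator_gradient_density[OF _ E(1,2)] by blast
  interpret finite_perimeter E M \<rho>
    by (rule finite_perimeter.intro) (fact E(1) E(2) M(1) M(2) \<rho>(1) parts)+
  have tv: "total_variation (\<lambda>A. indicator_gradient E A \<bullet> \<theta>) UNIV = ennreal (directional_variation \<theta>)" for \<theta>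
  proof -
    have "indicator_gradient E A \<bullet> \<theta> = (LINT x:A|M. \<rho> x \<bullet> \<theta>)" if "A \<in> sets borel" for A
      unfolding \<rho>(2)[OF that] set_lebesgue_integral_def
      using integral_inner_left[OF integrable_mult_indicator[OF _ \<rho>(1), of A], of \<theta>] that M(2) by simp
    then have "total_variation (\<lambda>A. indicator_gradient E A \<bullet> \<theta>) UNIV = (\<integral>\<^sup>+x. ennreal (norm (\<rho> x \<bullet> \<theta>)) \<partial>M)"
      by (intro total_variation_density M(2) integrable_\<rho>_inner)
    also have "\<dots> = ennreal (directional_variation \<theta>)"
      unfolding directional_variation_def real_norm_def
      by (intro nn_integral_eq_integral integrable_abs integrable_\<rho>_inner) auto
    finally show ?thesis .
  qed
  have per: "perimeter E = (\<integral>\<^sup>+x. ennreal (norm (\<rho> x)) \<partial>M)"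
    using ex total_variation_density[OF M(2) \<rho>] by (simp add: perimeter_def)
  show thesis by (rule that[OF finite_perimeter_axioms per tv])
qed

text \<open>Radial projection loses only the mass at the origin.\<close>

lemma angular_measure_prob_space:
  fixes lam :: "'a::euclidean_space measure"
  assumes "prob_space lam" "sets lam = sets borel" "emeasure lam {0} = 0"
  shows "prob_space (angular_measure lam)"
proof
  interpret prob_space lam by fact
  have space: "space lam = UNIV" using sets_eq_imp_space_eq[OF assms(2)] by simp
  have "polar_set {0<..} (sphere (0::'a) 1) = space lam - {0}"
    by (subst polar_set_alt) (auto simp: space)
  moreover have "emeasure lam (space lam - {0}) = 1"
    using assms(2,3) emeasure_space_1 by (subst emeasure_Diff) (auto simp: space)
  moreover have "sphere (0::'a) 1 \<in> sets sphere_borel" by (auto simp: sets_restrict_space)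
  ultimately show "emeasure (angular_measure lam) (space (angular_measure lam)) = 1"
    unfolding angular_measure_def using assms(2) by (simp add: emeasure_polar_measure)
qed

theorem corollary3p4:
  fixes \<nu> lam mu :: "real \<Rightarrow> 'a::euclidean_space measure"
    and R C :: "real \<Rightarrow> ennreal"
  assumes borel_nu: "\<And>\<epsilon>. \<epsilon> > 0 \<Longrightarrow> sets (\<nu> \<epsilon>) = sets borel"
    and levy_nu: "\<And>\<epsilon>. \<epsilon> > 0 \<Longrightarrow> (\<integral>\<^sup>+x. min 1 (ennreal (norm x)) \<partial>\<nu> \<epsilon>) < \<infinity>"
    and nu_0: "\<And>\<epsilon>. \<epsilon> > 0 \<Longrightarrow> emeasure (\<nu> \<epsilon>) {0} = 0"
    and R_ge_1: "\<And>\<epsilon>. \<epsilon> > 0 \<Longrightarrow> 1 \<le> R \<epsilon>"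
    and C_eq: "\<And>\<epsilon>. \<epsilon> > 0 \<Longrightarrow> C \<epsilon> = (\<integral>\<^sup>+x. min (R \<epsilon>) (ennreal (norm x)) \<partial>\<nu> \<epsilon>)"
    and C_pos: "\<And>\<epsilon>. \<epsilon> > 0 \<Longrightarrow> 0 < C \<epsilon>"
    and C_fin: "\<And>\<epsilon>. \<epsilon> > 0 \<Longrightarrow> C \<epsilon> < \<infinity>"
    and lam_eq: "\<And>\<epsilon>. \<epsilon> > 0 \<Longrightarrow>
      lam \<epsilon> = density (\<nu> \<epsilon>) (\<lambda>x. inverse (C \<epsilon>) * min (R \<epsilon>) (ennreal (norm x)))"
    and mu_eq: "\<And>\<epsilon>. \<epsilon> > 0 \<Longrightarrow> mu \<epsilon> = angular_measure (lam \<epsilon>)"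
    and lam_conc: "\<And>r::real. r > 0 \<Longrightarrow>
      ((\<lambda>\<epsilon>. emeasure (lam \<epsilon>) (- cball 0 r)) \<longlongrightarrow> 0) (at_right 0)"
  shows "\<exists>(\<epsilon> :: nat \<Rightarrow> real) (\<mu> :: 'a measure).
      (\<forall>j. \<epsilon> j > 0) \<and> \<epsilon> \<longlonglongrightarrow> 0 \<and>
      prob_space \<mu> \<and> sets \<mu> = sets (restrict_space borel (sphere 0 1)) \<and>
      sphere_weak_conv (\<lambda>j. mu (\<epsilon> j)) \<mu> \<and>
      (\<forall>E \<in> sets borel. emeasure lborel E < \<infinity> \<longrightarrow> perimeter E < \<infinity> \<longrightarrow>
         (\<lambda>j. inverse (C (\<epsilon> j)) * nonlocal_perimeter (\<nu> (\<epsilon> j)) E) \<longlonglongrightarrow>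
           1 / 2 * (\<integral>\<^sup>+\<theta>. total_variation (\<lambda>A. indicator_gradient E A \<bullet> \<theta>) UNIV \<partial>\<mu>)) \<and>
      (\<mu> = uniform_measure surface_measure (sphere 0 1) \<longrightarrow>
       (\<forall>E \<in> sets borel. emeasure lborel E < \<infinity> \<longrightarrow> perimeter E < \<infinity> \<longrightarrow>
         (\<forall>e::'a. norm e = 1 \<longrightarrow>
           (\<lambda>j. inverse (C (\<epsilon> j)) * nonlocal_perimeter (\<nu> (\<epsilon> j)) E) \<longlonglongrightarrow>
             (\<integral>\<^sup>+\<theta>. ennreal \<bar>e \<bullet> \<theta>\<bar> \<partial>surface_measure)
               / (2 * emeasure surface_measure (sphere 0 1 :: 'a set)) * perimeter E)))"
proof -
  have sets_lam: "sets (lam \<epsilon>) = sets borel" if "\<epsilon> > 0" for \<epsilon>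
    using lam_eq[OF that] borel_nu[OF that] by simp
  have weight: "(\<lambda>x. inverse (C \<epsilon>) * min (R \<epsilon>) (ennreal (norm x))) \<in> borel_measurable (\<nu> \<epsilon>)" if "\<epsilon> > 0" for \<epsilon>
    unfolding measurable_cong_sets[OF borel_nu[OF that] refl] by measurable
  have prob_lam: "prob_space (lam \<epsilon>)" if "\<epsilon> > 0" for \<epsilon>
  proof
    have "emeasure (lam \<epsilon>) (space (lam \<epsilon>)) = (\<integral>\<^sup>+x. inverse (C \<epsilon>) * min (R \<epsilon>) (ennreal (norm x)) \<partial>\<nu> \<epsilon>)"
      unfolding lam_eq[OF that] using weight[OF that] by (subst emeasure_density) (auto intro!: nn_integral_cong)
    also have "\<dots> = inverse (C \<epsilon>) * C \<epsilon>"
      unfolding C_eq[OF that]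
      by (rule nn_integral_cmult) (simp add: measurable_cong_sets[OF borel_nu[OF that] refl])
    also have "\<dots> = 1"
      using C_pos[OF that] C_fin[OF that] ennreal_divide_self[of "C \<epsilon>"] by (simp add: divide_ennreal_def mult.commute)
    finally show "emeasure (lam \<epsilon>) (space (lam \<epsilon>)) = 1" .
  qed
  have lam_0: "emeasure (lam \<epsilon>) {0} = 0" if "\<epsilon> > 0" for \<epsilon>
  proof -
    have "{0} \<in> null_sets (\<nu> \<epsilon>)" using nu_0[OF that] borel_nu[OF that] by (auto simp: null_sets_def)
    then have "{0} \<in> null_sets (lam \<epsilon>)"
      unfolding lam_eq[OF that] null_sets_density_iff[OF weight[OF that]]
      by (auto intro: AE_not_in eventually_mono)
    then show ?thesis by (simp add: null_sets_def)
  qed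
  define \<epsilon>0 :: "nat \<Rightarrow> real" where "\<epsilon>0 n = inverse (real (Suc n))" for n
  have \<epsilon>0: "\<epsilon>0 n > 0" "\<epsilon>0 \<longlonglongrightarrow> 0" for n
    unfolding \<epsilon>0_def[abs_def] using LIMSEQ_inverse_real_of_nat by auto
  have prob_mu: "prob_space (mu (\<epsilon>0 n))" "sets (mu (\<epsilon>0 n)) = sets sphere_borel" for n
    using angular_measure_prob_space[OF prob_lam sets_lam lam_0] \<epsilon>0(1)
    by (simp_all add: mu_eq) (simp add: angular_measure_def)
  \<comment> \<open>The subsequence is extracted from the angular measures alone, before any set is
    fixed; so one sequence and one limit serve every E.\<close>
  obtain r \<mu> where r: "strict_mono (r :: nat \<Rightarrow> nat)" and \<mu>: "prob_space \<mu>" "sets \<mu> = sets sphere_borel"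
    and conv: "sphere_weak_conv (\<lambda>n. mu (\<epsilon>0 (r n))) \<mu>"
    using sphere_weakly_compact[of "\<lambda>n. mu (\<epsilon>0 n)", OF prob_mu] by blast
  define \<epsilon> where "\<epsilon> j = \<epsilon>0 (r j)" for j
  have pos: "\<epsilon> j > 0" for j using \<epsilon>0(1) by (simp add: \<epsilon>_def)
  have \<epsilon>_lim: "\<epsilon> \<longlonglongrightarrow> 0"
    using LIMSEQ_subseq_LIMSEQ[OF \<epsilon>0(2) r] by (simp add: \<epsilon>_def[abs_def] comp_def)
  then have at0: "filterlim \<epsilon> (at_right 0) sequentially"
    using pos less_imp_neq[OF pos, symmetric] by (simp add: filterlim_at)
  have limit: "(\<lambda>j. inverse (C (\<epsilon> j)) * nonlocal_perimeter (\<nu> (\<epsilon> j)) E) \<longlonglongrightarrow>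
      ennreal ((\<integral>\<theta>. finite_perimeter.directional_variation M \<rho> \<theta> \<partial>\<mu>) / 2)"
    if "finite_perimeter E M \<rho>" for E :: "'a set" and M \<rho>
  proof -
    interpret finite_perimeter E M \<rho> by fact
    have "inverse (C (\<epsilon> j)) * nonlocal_perimeter (\<nu> (\<epsilon> j)) E
        = ennreal (\<integral>y. rescaled_exit_volume (R (\<epsilon> j)) y \<partial>lam (\<epsilon> j))" for j
      by (intro nonlocal_perimeter_eq_integral borel_nu nu_0 C_pos C_fin R_ge_1 lam_eq pos
          prob_space.finite_measure prob_lam)
    moreover have "(\<lambda>j. \<integral>y. rescaled_exit_volume (R (\<epsilon> j)) y \<partial>lam (\<epsilon> j))
        \<longlonglongrightarrow> (\<integral>\<theta>. directional_variation \<theta> \<partial>\<mu>) / 2"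
    proof (rule rescaled_exit_volume_limit)
      show "(\<lambda>j. emeasure (lam (\<epsilon> j)) (- cball 0 r)) \<longlonglongrightarrow> 0" if "r > 0" for r
        using filterlim_compose[OF lam_conc[OF that] at0] .
      show "sphere_weak_conv (\<lambda>j. angular_measure (lam (\<epsilon> j))) \<mu>"
        using conv unfolding mu_eq[OF pos, symmetric] by (simp add: \<epsilon>_def)
    qed (use prob_lam sets_lam R_ge_1 pos in auto)
    ultimately show ?thesis by simp
  qed
  \<comment> \<open>V is bounded on the sphere, so its extended integral is the
    \<open>ennreal\<close> of a real one, for which \<open>limit\<close> is stated.\<close>
  have half: "1 / 2 * (\<integral>\<^sup>+\<theta>. total_variation (\<lambda>A. indicator_gradient E A \<bullet> \<theta>) UNIV \<partial>\<mu>)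
      = ennreal ((\<integral>\<theta>. finite_perimeter.directional_variation M \<rho> \<theta> \<partial>\<mu>) / 2)"
    if "finite_perimeter E M \<rho>"
      and tv: "\<And>\<theta>. total_variation (\<lambda>A. indicator_gradient E A \<bullet> \<theta>) UNIV
        = ennreal (finite_perimeter.directional_variation M \<rho> \<theta>)" for E :: "'a set" and M \<rho>
  proof -
    interpret finite_perimeter E M \<rho> by fact
    interpret \<mu>: prob_space \<mu> by fact
    have "directional_variation \<in> borel_measurable \<mu>"
      unfolding measurable_cong_sets[OF \<mu>(2) refl] by (rule measurable_restrict_space1) measurable
    moreover have "space \<mu> = sphere 0 1"
      using sets_eq_imp_space_eq[OF \<mu>(2)] by (simp add: space_restrict_space)
    ultimately have "integrable \<mu> directional_variation"
      using directional_variation_nonneg directional_variation_le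
      by (intro \<mu>.integrable_const_bound[where B="\<integral>x. norm (\<rho> x) \<partial>M"] AE_I2) (auto, metis mult_1_right)
    then have "(\<integral>\<^sup>+\<theta>. ennreal (directional_variation \<theta>) \<partial>\<mu>) = ennreal (\<integral>\<theta>. directional_variation \<theta> \<partial>\<mu>)"
      by (intro nn_integral_eq_integral) (auto simp: directional_variation_nonneg)
    moreover have "1 / 2 * ennreal (\<integral>\<theta>. directional_variation \<theta> \<partial>\<mu>)
        = ennreal (\<integral>\<theta>. directional_variation \<theta> \<partial>\<mu>) / 2"
      by (simp only: divide_ennreal_def mult_1 mult.commute)
    moreover have "\<dots> = ennreal ((\<integral>\<theta>. directional_variation \<theta> \<partial>\<mu>) / 2)"
      by (rule ennreal_divide_numeral) (simp add: directional_variation_nonneg)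
    ultimately show ?thesis unfolding tv by (simp only:)
  qed
  have main: "(\<lambda>j. inverse (C (\<epsilon> j)) * nonlocal_perimeter (\<nu> (\<epsilon> j)) E) \<longlonglongrightarrow>
      1 / 2 * (\<integral>\<^sup>+\<theta>. total_variation (\<lambda>A. indicator_gradient E A \<bullet> \<theta>) UNIV \<partial>\<mu>)"
    if E: "E \<in> sets borel" "emeasure lborel E < \<infinity>" "perimeter E < \<infinity>" for E :: "'a set"
  proof -
    obtain M \<rho> where fp: "finite_perimeter E M \<rho>"
      and tv: "\<And>\<theta>. total_variation (\<lambda>A. indicator_gradient E A \<bullet> \<theta>) UNIV
        = ennreal (finite_perimeter.directional_variation M \<rho> \<theta>)"
      by (rule finite_perimeter_exists[OF E]) iprover
    show ?thesis unfolding half[OF fp tv] by (rule limit[OF fp])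
  qed
  have uniform: "1 / 2 * (\<integral>\<^sup>+\<theta>. total_variation (\<lambda>A. indicator_gradient E A \<bullet> \<theta>) UNIV \<partial>\<mu>)
      = (\<integral>\<^sup>+\<theta>. ennreal \<bar>e \<bullet> \<theta>\<bar> \<partial>surface_measure)
               / (2 * emeasure surface_measure (sphere 0 1 :: 'a set)) * perimeter E"
    if \<mu>_eq: "\<mu> = uniform_measure surface_measure (sphere 0 1)"
      and E: "E \<in> sets borel" "emeasure lborel E < \<infinity>" "perimeter E < \<infinity>" and e: "norm e = 1"
    for E and e :: 'a
  proof -
    let ?S = "surface_measure :: 'a measure" and ?\<kappa> = "emeasure surface_measure (sphere 0 1 :: 'a set)"
    let ?K = "\<integral>\<^sup>+\<theta>. ennreal \<bar>e \<bullet> \<theta>\<bar> \<partial>?S"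
    have sets_S: "sets ?S = sets sphere_borel" by (simp add: surface_measure_def)
    have sph: "sphere 0 1 \<in> sets ?S" unfolding sets_S by (auto simp: sets_restrict_space)
    have space_S: "space ?S = sphere 0 1"
      using sets_eq_imp_space_eq[OF sets_S] by (simp add: space_restrict_space)
    \<comment> \<open>The area of the sphere is not computed. In \<open>ennreal\<close> both
      \<open>0 / 0\<close> and \<open>top / top\<close> are 0, so the fact that the normalised
      measure has mass 1 forces 0 < \<kappa> < \<infinity>.\<close>
    have "emeasure \<mu> (sphere 0 1) = 1"
      using prob_space.emeasure_space_1[OF \<mu>(1)] space_S by (simp add: \<mu>_eq)
    then have "?\<kappa> / ?\<kappa> = 1" using sph by (simp add: \<mu>_eq)
    then have \<kappa>: "?\<kappa> \<noteq> 0" "?\<kappa> < \<infinity>" by (auto simp: less_top[symmetric])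
    obtain M \<rho> where fp: "finite_perimeter E M \<rho>" and per: "perimeter E = (\<integral>\<^sup>+x. ennreal (norm (\<rho> x)) \<partial>M)"
      and tv: "\<And>\<theta>. total_variation (\<lambda>A. indicator_gradient E A \<bullet> \<theta>) UNIV
        = ennreal (finite_perimeter.directional_variation M \<rho> \<theta>)"
      by (rule finite_perimeter_exists[OF E]) iprover
    interpret finite_perimeter E M \<rho> by fact
    have meas: "(\<lambda>\<theta>. ennreal (directional_variation \<theta>)) \<in> borel_measurable ?S"
      unfolding measurable_cong_sets[OF sets_S refl] by (rule measurable_restrict_space1) measurable
    have "(\<integral>\<^sup>+\<theta>. ennreal (directional_variation \<theta>) \<partial>\<mu>)
        = (\<integral>\<^sup>+\<theta>. ennreal (directional_variation \<theta>) * indicator (sphere 0 1) \<theta> \<partial>?S) / ?\<kappa>"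
      unfolding \<mu>_eq by (rule nn_integral_uniform_measure[OF meas sph])
    also have "(\<integral>\<^sup>+\<theta>. ennreal (directional_variation \<theta>) * indicator (sphere 0 1) \<theta> \<partial>?S)
        = (\<integral>\<^sup>+\<theta>. ennreal (directional_variation \<theta>) \<partial>?S)"
      by (intro nn_integral_cong) (simp add: space_S)
    also have "\<dots> = ?K * perimeter E"
      unfolding per by (rule surface_directional_variation[OF \<kappa>(2) e])
    finally have eq: "(\<integral>\<^sup>+\<theta>. total_variation (\<lambda>A. indicator_gradient E A \<bullet> \<theta>) UNIV \<partial>\<mu>) = ?K * perimeter E / ?\<kappa>"
      unfolding tv .
    obtain k where k: "?\<kappa> = ennreal k" "k > 0" using \<kappa> by (cases ?\<kappa>) (auto simp: zero_less_iff_neq_zero)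
    \<comment> \<open>Inversion in \<open>ennreal\<close> is not multiplicative in general, 0 times
      \<infinity> being the exception; the finite positive value of \<kappa> allows the identity to
      be read off in the reals.\<close>
    have inv: "inverse (2 * ?\<kappa>) = inverse 2 * inverse ?\<kappa>"
    proof -
      have "2 * ?\<kappa> = ennreal (2 * k)" using k by (simp add: ennreal_mult)
      then have "inverse (2 * ?\<kappa>) = ennreal (inverse 2 * inverse k)"
        using k(2) inverse_ennreal[of "2 * k"] by simp
      also have "\<dots> = ennreal (inverse 2) * ennreal (inverse k)" using k(2) by (intro ennreal_mult) auto
      also have "\<dots> = inverse 2 * inverse ?\<kappa>"
        using inverse_ennreal[of 2] inverse_ennreal[OF k(2)] k(1) by simp
      finally show ?thesis .
    qed
    show ?thesis
      unfolding eq divide_ennreal_def inv by (simp add: mult_ac)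
  qed
  show ?thesis
  proof (intro exI conjI allI impI ballI)
    show "sphere_weak_conv (\<lambda>j. mu (\<epsilon> j)) \<mu>" using conv by (simp add: \<epsilon>_def)
  qed (use pos \<epsilon>_lim \<mu> main uniform in auto)
qed

end
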